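(* Let $H$ be a graph with chromatic number $3$. Then there is a smallest positive integer $g$ such that $H$ is not homomorphic to the cycle $C_{2g+1}$, and for this $g$, \[ \delta_{H} = \frac{2}{2g+1}. \]
   Context: All graphs are finite and simple. A graph $G$ is homomorphic to a graph $F$ if there is a map $\varphi: V(G)\to V(F)$ with $\varphi(u)\varphi(v)\in E(F)$ for every edge $uv$ of $G$. $\delta(G)$ denotes the minimum degree and $|G|$ the number of vertices. An $n$-vertex graph is $F$-free if it contains no (not necessarily induced) subgraph isomorphic to $F$. For a graph $H$ of chromatic number $r+1$, $\delta_H$ is defined as the infimum of all $c$ with the following property: for every $\eta>0$ there is $n_0$ such that every $H$-free graph $G$ on $n\ge n_0$ vertices with $\delta(G)\ge cn$ can be made $r$-partite by deleting at most $\eta n^2$ edges (i.e. "can be made $r$-partite by deleting $o(n^2)$ edges"). *)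

theory Defs
  imports Complex_Main
begin

type_synonym 'a graph = "'a set \<times> 'a set set"

abbreviation verts :: "'a graph \<Rightarrow> 'a set" where "verts G \<equiv> fst G"
abbreviation edges :: "'a graph \<Rightarrow> 'a set set" where "edges G \<equiv> snd G"

definition simple_graph :: "'a graph \<Rightarrow> bool" where
  "simple_graph G \<longleftrightarrow> finite (verts G) \<and> (\<forall>e\<in>edges G. e \<subseteq> verts G \<and> card e = 2)"

definition homomorphic :: "'a graph \<Rightarrow> 'b graph \<Rightarrow> bool" where
  "homomorphic G F \<longleftrightarrow>
     (\<exists>\<phi>. \<phi> ` verts G \<subseteq> verts F \<and> (\<forall>u v. {u, v} \<in> edges G \<longrightarrow> {\<phi> u, \<phi> v} \<in> edges F))"

definition subgraph :: "'a graph \<Rightarrow> 'a graph \<Rightarrow> bool" where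
  "subgraph G' G \<longleftrightarrow> simple_graph G' \<and> verts G' \<subseteq> verts G \<and> edges G' \<subseteq> edges G"

definition isomorphic :: "'a graph \<Rightarrow> 'b graph \<Rightarrow> bool" where
  "isomorphic F G \<longleftrightarrow>
     (\<exists>\<phi>. bij_betw \<phi> (verts F) (verts G) \<and>
          (\<forall>u\<in>verts F. \<forall>v\<in>verts F. {u, v} \<in> edges F \<longleftrightarrow> {\<phi> u, \<phi> v} \<in> edges G))"

definition free_of :: "'a graph \<Rightarrow> 'b graph \<Rightarrow> bool" where
  "free_of F G \<longleftrightarrow> \<not> (\<exists>G'. subgraph G' G \<and> isomorphic F G')"

definition degree :: "'a graph \<Rightarrow> 'a \<Rightarrow> nat" where
  "degree G v = card {e \<in> edges G. v \<in> e}"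

text \<open>Unspecified for the graph without vertices.\<close>
definition min_degree :: "'a graph \<Rightarrow> nat" where
  "min_degree G = Min (degree G ` verts G)"

definition partite :: "nat \<Rightarrow> 'a graph \<Rightarrow> bool" where
  "partite r G \<longleftrightarrow>
     (\<exists>f :: 'a \<Rightarrow> nat. f ` verts G \<subseteq> {..<r} \<and> (\<forall>u v. {u, v} \<in> edges G \<longrightarrow> f u \<noteq> f v))"

definition chromatic_number :: "'a graph \<Rightarrow> nat" where
  "chromatic_number G = (LEAST r. partite r G)"

text \<open>Intended for \<open>n \<ge> 3\<close>.\<close>
definition cycle_graph :: "nat \<Rightarrow> nat graph" where
  "cycle_graph n = ({..<n}, {{i, Suc i mod n} | i. i < n})"

text \<open>The host graphs \<open>G\<close> have vertices of type \<^typ>\<open>nat\<close>, which covers every finite graph up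
  to isomorphism. The value of \<^const>\<open>min_degree\<close> at the graph without vertices
  does not matter, since \<open>n\<^sub>0\<close> may be taken positive.\<close>
definition forces_near_partite :: "'a graph \<Rightarrow> real \<Rightarrow> bool" where
  "forces_near_partite H c \<longleftrightarrow>
     (\<forall>\<eta>>0. \<exists>n\<^sub>0. \<forall>G :: nat graph.
        simple_graph G \<and> card (verts G) \<ge> n\<^sub>0 \<and> free_of H G \<and>
        real (min_degree G) \<ge> c * real (card (verts G)) \<longrightarrow>
        (\<exists>D\<subseteq>edges G. real (card D) \<le> \<eta> * (real (card (verts G)))\<^sup>2 \<and>
           partite (chromatic_number H - 1) (verts G, edges G - D)))"

text \<open>Meaningful when \<open>H\<close> has chromatic number at least 3: then the set is nonempty (any
  \<open>c > 1\<close> belongs to it vacuously) and bounded below by 0. For bipartite \<open>H\<close> it is unbounded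
  below.\<close>
definition stability_threshold :: "'a graph \<Rightarrow> real" where
  "stability_threshold H = Inf {c. forces_near_partite H c}"

end

theory Submission
  imports Defs "HOL-Library.FuncSet"
begin

text \<open>Lower bound: the balanced blow-up of the cycle of length \<open>2 g + 1\<close> contains no copy of \<open>H\<close>, has
  minimum degree \<open>2 n / (2 g + 1)\<close>, and contains quadratically many edge-disjoint odd cycles.

  Upper bound, for \<open>c > 2 / (2 g + 1)\<close>, without the regularity lemma: let \<open>G\<close> be \<open>H\<close>-free with minimum
  degree at least \<open>c n\<close>. For odd \<open>l < 2 g + 1\<close>, \<open>H\<close> maps to the cycle of length \<open>l\<close>, so by Erdos's theorem on
  complete multipartite hypergraphs \<open>G\<close> has only \<open>o(n^l)\<close> closed walks of length \<open>l\<close>. For odd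
  \<open>l \<ge> 2 g + 1\<close> the same follows by induction, as in Andrasfai's theorem: counting edges between a closed walk and all vertices,
  \<open>l c > 2\<close> forces many vertices with three neighbours on the walk, and each of those creates a shorter odd closed
  walk. On the other hand, a graph of linear minimum degree that is far from bipartite has, for some
  odd \<open>l\<close> of bounded size, a positive proportion of all \<open>l\<close>-tuples as closed walks.\<close>

section \<open>Boxes in dense sets of tuples\<close>

text \<open>The pulled-back tuple and the restriction of \<open>x\<close> to the coordinates outside
  the image of \<open>\<iota>\<close> together determine \<open>x\<close>. So each member of
  \<open>Y\<close> arises from at most \<open>card V ^ (card I - card J)\<close> tuples.\<close>

lemma card_PiE_pullback_le:
  assumes "finite V" "finite I" "finite Y" "inj_on \<iota> J" "\<iota> ` J \<subseteq> I" "X \<subseteq> I \<rightarrow>\<^sub>E V"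
    and "\<And>x. x \<in> X \<Longrightarrow> (\<lambda>j\<in>J. x (\<iota> j)) \<in> Y"
  shows "card X \<le> card Y * card V ^ (card I - card J)"
proof -
  let ?K = "I - \<iota> ` J"
  let ?f = "\<lambda>x. (\<lambda>j\<in>J. x (\<iota> j), restrict x ?K)"
  have "inj_on ?f X"
  proof (rule inj_onI)
    fix x y assume xy: "x \<in> X" "y \<in> X" "?f x = ?f y"
    show "x = y"
    proof (rule PiE_ext[of x I "\<lambda>_. V" y])
      show "x \<in> I \<rightarrow>\<^sub>E V" "y \<in> I \<rightarrow>\<^sub>E V" using xy assms(6) by auto
      fix i assume i: "i \<in> I"
      show "x i = y i"
      proof (cases "i \<in> \<iota> ` J")
        case True
        then obtain j where "j \<in> J" "i = \<iota> j" by blast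
        then show ?thesis using xy(3) by (auto dest!: fun_cong[of _ _ j])
      next
        case False
        then show ?thesis using xy(3) i by (auto dest!: fun_cong[of "restrict x ?K" _ i])
      qed
    qed
  qed
  moreover have "?f ` X \<subseteq> Y \<times> (?K \<rightarrow>\<^sub>E V)"
    using assms(6,7) by (auto simp: PiE_iff split: if_splits)
  moreover have fin: "finite (?K \<rightarrow>\<^sub>E V)" using assms(1,2) by (intro finite_PiE) auto
  ultimately have "card X \<le> card (Y \<times> (?K \<rightarrow>\<^sub>E V))"
    using assms(3) by (intro card_inj_on_le[of ?f]) auto
  also have "\<dots> = card Y * card V ^ card ?K"
    using assms by (simp add: card_cartesian_product card_PiE)
  also have "card ?K = card I - card J"
    using assms by (simp add: card_Diff_subset card_image finite_subset)
  finally show ?thesis .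
qed

text \<open>This is Erdos's theorem on complete multipartite hypergraphs, by induction on the number
  of coordinates. Split off the last coordinate and double count pairs of a prefix and an
  \<open>h\<close>-set of admissible last entries. Some \<open>h\<close>-set \<open>Q\<close> serves
  a positive proportion of all prefixes; the induction hypothesis gives a box among these prefixes,
  and \<open>Q\<close> becomes the last side.\<close>

lemma dense_set_contains_box:
  fixes h q :: nat and \<epsilon> :: real
  assumes "\<epsilon> > 0" "h > 0"
  shows "\<forall>\<^sub>F n in sequentially. \<forall>(V :: 'a set) X. finite V \<and> card V = n \<and> X \<subseteq> {..<q} \<rightarrow>\<^sub>E V \<and>
     real (card X) \<ge> \<epsilon> * real n ^ q \<longrightarrow>
     (\<exists>B. (\<forall>i<q. B i \<subseteq> V \<and> card (B i) = h) \<and> PiE {..<q} B \<subseteq> X)"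
  using assms(1)
proof (induction q arbitrary: \<epsilon>)
  case 0
  show ?case
  proof (intro always_eventually allI impI)
    fix n and V :: "'a set" and X :: "(nat \<Rightarrow> 'a) set"
    assume *: "finite V \<and> card V = n \<and> X \<subseteq> {..<0} \<rightarrow>\<^sub>E V \<and> real (card X) \<ge> \<epsilon> * real n ^ 0"
    then have "X \<noteq> {}" using 0 by auto
    with * have "X = {\<lambda>_. undefined}" by auto
    then show "\<exists>B. (\<forall>i<0. B i \<subseteq> V \<and> card (B i) = h) \<and> PiE {..<0} B \<subseteq> X" by auto
  qed
next
  case (Suc q)
  \<comment> \<open>The first factor is the proportion of prefixes with many extensions. The second
    comes from \<open>(k / h) ^ h\<close>, a lower bound for the number of \<open>h\<close>-subsets
    of a \<open>k\<close>-set, with \<open>k\<close> at least \<open>\<epsilon> / 2 * n\<close>,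
    after division by the at most \<open>n ^ h\<close> choices of \<open>Q\<close>.\<close>
  define \<epsilon>' where "\<epsilon>' = \<epsilon> / 2 * (\<epsilon> / (2 * h)) ^ h"
  have "\<epsilon>' > 0" using Suc.prems assms(2) by (simp add: \<epsilon>'_def)
  from Suc.IH[OF this] have
    "\<forall>\<^sub>F n in sequentially. \<forall>(V :: 'a set) X. finite V \<and> card V = n \<and> X \<subseteq> {..<q} \<rightarrow>\<^sub>E V \<and>
     real (card X) \<ge> \<epsilon>' * real n ^ q \<longrightarrow>
     (\<exists>B. (\<forall>i<q. B i \<subseteq> V \<and> card (B i) = h) \<and> PiE {..<q} B \<subseteq> X)" .
  moreover have "\<forall>\<^sub>F n in sequentially. n \<ge> nat \<lceil>2 * h / \<epsilon>\<rceil> + 1"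
    by (rule eventually_ge_at_top)
  ultimately show ?case
  proof eventually_elim
    case (elim n)
    have npos: "n > 0" using elim(2) by linarith
    have "2 * h / \<epsilon> \<le> n" using elim(2) by linarith
    \<comment> \<open>The lower bound for the binomial coefficient used below requires at least
      \<open>h\<close> extensions.\<close>
    then have nh: "h \<le> \<epsilon> / 2 * n" using Suc.prems by (simp add: field_simps)
    show ?case
    proof (intro allI impI)
      fix V :: "'a set" and X
      assume "finite V \<and> card V = n \<and> X \<subseteq> {..<Suc q} \<rightarrow>\<^sub>E V \<and> real (card X) \<ge> \<epsilon> * real n ^ Suc q"
      then have V: "finite V" "card V = n" and X: "X \<subseteq> {..<Suc q} \<rightarrow>\<^sub>E V"
        and cX: "real (card X) \<ge> \<epsilon> * real n ^ Suc q" by auto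
      define P where "P = {..<q} \<rightarrow>\<^sub>E V"
      define F where "F x = {v \<in> V. x(q := v) \<in> X}" for x
      have finP: "finite P" and cP: "card P = n ^ q"
        using V by (auto simp: P_def card_PiE intro: finite_PiE)
      have finF: "finite (F x)" and cF: "card (F x) \<le> n" for x
        using V by (auto simp: F_def intro: card_mono)
      have "card X \<le> card (Sigma P F)"
      proof (rule card_inj_on_le)
        show "inj_on (\<lambda>x. (restrict x {..<q}, x q)) X"
        proof (rule inj_onI)
          fix x y assume xy: "x \<in> X" "y \<in> X" "(restrict x {..<q}, x q) = (restrict y {..<q}, y q)"
          show "x = y"
          proof (rule PiE_ext[of x "{..<Suc q}" "\<lambda>_. V" y])
            show "x \<in> {..<Suc q} \<rightarrow>\<^sub>E V" "y \<in> {..<Suc q} \<rightarrow>\<^sub>E V" using xy X by auto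
            fix i assume "i \<in> {..<Suc q}"
            then show "x i = y i" using xy(3)
              by (cases "i = q") (auto dest!: fun_cong[of "restrict x {..<q}" _ i])
          qed
        qed
        have "(restrict x {..<q})(q := x q) = x" if "x \<in> X" for x
        proof -
          have "x \<in> {..<Suc q} \<rightarrow>\<^sub>E V" using that X by auto
          then show ?thesis by (auto simp: fun_eq_iff PiE_iff extensional_def restrict_def)
        qed
        then show "(\<lambda>x. (restrict x {..<q}, x q)) ` X \<subseteq> Sigma P F"
          using X by (auto simp: P_def F_def PiE_iff split: if_splits)
        show "finite (Sigma P F)" using finP finF by auto
      qed
      also have "card (Sigma P F) = (\<Sum>x\<in>P. card (F x))"
        using finP finF by (simp add: card_SigmaI)
      finally have cX2: "card X \<le> (\<Sum>x\<in>P. card (F x))" .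
      \<comment> \<open>Prefixes outside \<open>A\<close> account for at most half of the guaranteed
        size of \<open>X\<close>, and each prefix in \<open>A\<close> for at most \<open>n\<close>
        members, so \<open>A\<close> is large.\<close>
      define A where "A = {x \<in> P. real (card (F x)) \<ge> \<epsilon> / 2 * n}"
      have finA: "finite A" "A \<subseteq> P" using finP by (auto simp: A_def)
      have "real (card X) \<le> (\<Sum>x\<in>P. real (card (F x)))"
        using cX2 by (metis of_nat_le_iff of_nat_sum)
      also have "\<dots> \<le> (\<Sum>x\<in>P. (if x \<in> A then real n else 0) + \<epsilon> / 2 * n)"
      proof (rule sum_mono)
        fix x assume "x \<in> P"
        then show "real (card (F x)) \<le> (if x \<in> A then real n else 0) + \<epsilon> / 2 * n"
          using cF[of x] Suc.prems by (auto simp: A_def add_increasing2)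
      qed
      also have "\<dots> = card A * n + n ^ q * (\<epsilon> / 2 * n)"
        using finP finA cP by (simp add: sum.distrib sum.If_cases Int_absorb1)
      finally have "\<epsilon> * real n ^ Suc q \<le> card A * n + n ^ q * (\<epsilon> / 2 * n)" using cX by simp
      then have "(\<epsilon> / 2 * real n ^ q) * n \<le> real (card A) * n" by (simp add: algebra_simps)
      then have cA: "\<epsilon> / 2 * real n ^ q \<le> card A" using npos by simp
      define S where "S = {Q. Q \<subseteq> V \<and> card Q = h}"
      have finS: "finite S" using V by (auto simp: S_def)
      have cS: "card S \<le> n ^ h"
      proof (cases "h \<le> n")
        case True
        then show ?thesis using V by (simp add: S_def n_subsets binomial_le_pow)
      next
        case False
        then show ?thesis using V by (simp add: S_def n_subsets binomial_eq_0)
      qed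
      define C where "C Q = {x \<in> P. Q \<subseteq> F x}" for Q
      have finC: "finite (C Q)" for Q using finP by (auto simp: C_def)
      \<comment> \<open>Double counting of the pairs of a prefix \<open>x\<close> and an
        \<open>h\<close>-set \<open>Q\<close> contained in \<open>F x\<close>, first by prefixes in
        \<open>A\<close>, then by \<open>Q\<close>.\<close>
      have "(\<epsilon> / 2 * real n ^ q) * (\<epsilon> / 2 * n / h) ^ h \<le> card A * (\<epsilon> / 2 * n / h) ^ h"
        using cA Suc.prems by (intro mult_right_mono) auto
      also have "\<dots> = (\<Sum>x\<in>A. (\<epsilon> / 2 * n / h) ^ h)" by simp
      also have "\<dots> \<le> (\<Sum>x\<in>A. real (card {Q \<in> S. Q \<subseteq> F x}))"
      proof (rule sum_mono)
        fix x assume x: "x \<in> A"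
        have "{Q \<in> S. Q \<subseteq> F x} = {Q. Q \<subseteq> F x \<and> card Q = h}" by (auto simp: S_def F_def)
        then have "card {Q \<in> S. Q \<subseteq> F x} = card (F x) choose h"
          using finF by (simp add: n_subsets)
        moreover have "h \<le> card (F x)" using x nh by (auto simp: A_def)
        then have "(card (F x) / h) ^ h \<le> real (card (F x) choose h)"
          by (rule binomial_ge_n_over_k_pow_k)
        moreover have "(\<epsilon> / 2 * n / h) ^ h \<le> (card (F x) / h) ^ h"
          using x Suc.prems by (intro power_mono divide_right_mono) (auto simp: A_def)
        ultimately show "(\<epsilon> / 2 * n / h) ^ h \<le> real (card {Q \<in> S. Q \<subseteq> F x})" by simp
      qed
      also have "\<dots> \<le> (\<Sum>x\<in>P. real (card {Q \<in> S. Q \<subseteq> F x}))"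
        using finP finA by (intro sum_mono2) auto
      also have "\<dots> = (\<Sum>Q\<in>S. real (card (C Q)))"
      proof -
        have "(\<Sum>x\<in>P. card {Q \<in> S. Q \<subseteq> F x}) = (\<Sum>x\<in>P. \<Sum>Q\<in>S. if Q \<subseteq> F x then 1 else 0)"
          using finS by (simp add: sum.If_cases Int_def)
        also have "\<dots> = (\<Sum>Q\<in>S. \<Sum>x\<in>P. if Q \<subseteq> F x then 1 else 0)" by (rule sum.swap)
        also have "\<dots> = (\<Sum>Q\<in>S. card (C Q))" using finP by (simp add: C_def sum.If_cases Int_def)
        finally show ?thesis by (simp flip: of_nat_sum)
      qed
      finally have tot: "(\<epsilon> / 2 * real n ^ q) * (\<epsilon> / 2 * n / h) ^ h \<le> (\<Sum>Q\<in>S. real (card (C Q)))" .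
      have eq: "(\<epsilon> / 2 * real n ^ q) * (\<epsilon> / 2 * n / h) ^ h = real n ^ h * (\<epsilon>' * real n ^ q)"
        by (simp add: \<epsilon>'_def power_mult_distrib power_divide field_simps)
      have "\<exists>Q\<in>S. real (card (C Q)) \<ge> \<epsilon>' * real n ^ q"
      proof (rule ccontr)
        assume "\<not> ?thesis"
        then have lt: "\<And>Q. Q \<in> S \<Longrightarrow> real (card (C Q)) < \<epsilon>' * real n ^ q" by force
        have pos: "0 < \<epsilon>' * real n ^ q" using \<open>\<epsilon>' > 0\<close> npos by simp
        show False
        proof (cases "S = {}")
          case True
          moreover have "0 < real n ^ h * (\<epsilon>' * real n ^ q)" using pos npos by simp
          ultimately show False using tot unfolding eq by simp
        next
          case False
          have "(\<Sum>Q\<in>S. real (card (C Q))) < (\<Sum>Q\<in>S. \<epsilon>' * real n ^ q)"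
            using lt finS False by (intro sum_strict_mono) auto
          also have "\<dots> = card S * (\<epsilon>' * real n ^ q)" by simp
          also have "\<dots> \<le> real n ^ h * (\<epsilon>' * real n ^ q)"
            using cS pos by (intro mult_right_mono) (auto simp flip: of_nat_power)
          finally show False using tot eq by simp
        qed
      qed
      then obtain Q where Q: "Q \<in> S" "real (card (C Q)) \<ge> \<epsilon>' * real n ^ q" by blast
      have "C Q \<subseteq> {..<q} \<rightarrow>\<^sub>E V" by (auto simp: C_def P_def)
      then obtain B where B: "\<forall>i<q. B i \<subseteq> V \<and> card (B i) = h" "PiE {..<q} B \<subseteq> C Q"
        using elim(1) V Q(2) by blast
      have "PiE {..<Suc q} (B(q := Q)) \<subseteq> X"
      proof
        fix x assume x: "x \<in> PiE {..<Suc q} (B(q := Q))"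
        have "x i \<in> B i" if "i < q" for i using PiE_mem[OF x, of i] that by simp
        then have "restrict x {..<q} \<in> PiE {..<q} B" by auto
        then have "restrict x {..<q} \<in> C Q" using B(2) by blast
        then have "Q \<subseteq> F (restrict x {..<q})" by (simp add: C_def)
        moreover have "x q \<in> Q" using PiE_mem[OF x, of q] by simp
        ultimately have "(restrict x {..<q})(q := x q) \<in> X" by (auto simp: F_def)
        moreover have "(restrict x {..<q})(q := x q) = x"
          using x by (auto simp: fun_eq_iff PiE_iff extensional_def restrict_def)
        ultimately show "x \<in> X" by simp
      qed
      moreover have "\<forall>i<Suc q. (B(q := Q)) i \<subseteq> V \<and> card ((B(q := Q)) i) = h"
        using B(1) Q(1) by (auto simp: S_def less_Suc_eq)
      ultimately show "\<exists>B. (\<forall>i<Suc q. B i \<subseteq> V \<and> card (B i) = h) \<and> PiE {..<Suc q} B \<subseteq> X"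
        by blast
    qed
  qed
qed

section \<open>Closed walks in graphs without a copy of \<open>H\<close>\<close>

text \<open>Greedy choice: the values taken earlier are fewer than \<open>card U\<close>, hence
  never exhaust the next set.\<close>

lemma injective_choice:
  assumes "finite U" "\<And>u. u \<in> U \<Longrightarrow> finite (S u) \<and> card U \<le> card (S u)"
  shows "\<exists>f. inj_on f U \<and> (\<forall>u\<in>U. f u \<in> S u)"
  using assms
proof (induction U rule: finite_induct)
  case (insert a U)
  have "finite (S u) \<and> card U \<le> card (S u)" if "u \<in> U" for u
    using insert.prems[of u] insert.hyps that by auto
  from insert.IH[OF this] obtain f where f: "inj_on f U" "\<forall>u\<in>U. f u \<in> S u" by blast
  have "card (f ` U) < card (S a)"
    using insert.prems[of a] insert.hyps card_image_le[of U f] by simp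
  then have "\<not> S a \<subseteq> f ` U"
    using insert.hyps by (metis card_mono finite_imageI leD)
  then obtain b where b: "b \<in> S a" "b \<notin> f ` U" by blast
  have "inj_on (f(a := b)) (insert a U)"
    using f(1) b(2) insert.hyps by (auto simp: inj_on_def)
  moreover have "\<forall>u\<in>insert a U. (f(a := b)) u \<in> S u" using f(2) b(1) insert.hyps by auto
  ultimately show ?case by blast
qed auto

text \<open>These are the homomorphisms from the cycle of length \<open>l\<close> for
  \<open>l \<ge> 3\<close>: starting point and direction are part of the tuple and vertices may
  repeat, so the natural scale is \<open>n ^ l\<close>.\<close>

definition closed_walks :: "'a graph \<Rightarrow> nat \<Rightarrow> (nat \<Rightarrow> 'a) set" where
  "closed_walks G l = {x \<in> {..<l} \<rightarrow>\<^sub>E verts G. \<forall>i<l. {x i, x (Suc i mod l)} \<in> edges G}"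

lemma finite_closed_walks [simp]: "finite (verts G) \<Longrightarrow> finite (closed_walks G l)"
  by (rule finite_subset[of _ "{..<l} \<rightarrow>\<^sub>E verts G"]) (auto simp: closed_walks_def intro: finite_PiE)

lemma edge_imp_verts:
  assumes "simple_graph G" "{u, v} \<in> edges G"
  shows "u \<in> verts G" "v \<in> verts G" "u \<noteq> v"
  using assms unfolding simple_graph_def by fastforce+

text \<open>The box makes cyclically consecutive classes completely joined. Each vertex
  \<open>u\<close> of \<open>H\<close> is placed in the class \<open>B (\<phi> u)\<close>; classes
  that are not consecutive may overlap, so the images are chosen greedily to be distinct across all
  classes.\<close>

lemma cycle_blowup_contains:
  assumes H: "simple_graph H" "homomorphic H (cycle_graph q)" and q: "q \<ge> 3"
    and G: "simple_graph G"
    and B: "\<And>i. i < q \<Longrightarrow> B i \<subseteq> verts G \<and> card (B i) = card (verts H)"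
    and box: "PiE {..<q} B \<subseteq> closed_walks G q"
  shows "\<not> free_of H G"
proof -
  obtain \<phi> where \<phi>: "\<phi> ` verts H \<subseteq> {..<q}"
    "\<And>u v. {u, v} \<in> edges H \<Longrightarrow> {\<phi> u, \<phi> v} \<in> edges (cycle_graph q)"
    using H(2) unfolding homomorphic_def cycle_graph_def by auto
  have finG: "finite (verts G)" and finH: "finite (verts H)"
    using G H by (auto simp: simple_graph_def)
  have "\<exists>f. inj_on f (verts H) \<and> (\<forall>u\<in>verts H. f u \<in> B (\<phi> u))"
  proof (rule injective_choice[OF finH])
    fix u assume "u \<in> verts H"
    then have "\<phi> u < q" using \<phi>(1) by auto
    then show "finite (B (\<phi> u)) \<and> card (verts H) \<le> card (B (\<phi> u))"
      using B finite_subset[OF _ finG] by auto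
  qed
  then obtain f where f: "inj_on f (verts H)" "\<And>u. u \<in> verts H \<Longrightarrow> f u \<in> B (\<phi> u)" by blast
  \<comment> \<open>Since all classes are nonempty, \<open>b\<close> and \<open>b'\<close> extend to
    a tuple of the box, which is a closed walk using the pair as one of its steps.\<close>
  have adj: "{b, b'} \<in> edges G" if i: "i < q" "b \<in> B i" "b' \<in> B (Suc i mod q)" for i b b'
  proof -
    have "\<exists>z. z \<in> B j" if "j < q" for j
    proof -
      have "card (B i) > 0" using i B[OF i(1)] finG
        by (metis card_gt_0_iff empty_iff finite_subset)
      then have "card (B j) > 0" using B i(1) that by simp
      then show ?thesis by (metis card_gt_0_iff ex_in_conv)
    qed
    then obtain z where z: "\<And>j. j < q \<Longrightarrow> z j \<in> B j" by metis
    define x where "x = (\<lambda>j\<in>{..<q}. if j = i then b else if j = Suc i mod q then b' else z j)"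
    have ne: "Suc i mod q \<noteq> i" "Suc i mod q < q" using q i(1) by (auto simp: mod_Suc)
    have "x \<in> PiE {..<q} B" using i z by (auto simp: x_def)
    then have "{x i, x (Suc i mod q)} \<in> edges G" using box i(1) by (auto simp: closed_walks_def)
    then show ?thesis using i ne by (simp add: x_def)
  qed
  have hom: "{f u, f v} \<in> edges G" if uv: "{u, v} \<in> edges H" for u v
  proof -
    have "u \<in> verts H" "v \<in> verts H" using edge_imp_verts[OF H(1) uv] by auto
    then have fuv: "f u \<in> B (\<phi> u)" "f v \<in> B (\<phi> v)" using f by auto
    obtain i where i: "i < q" "{\<phi> u, \<phi> v} = {i, Suc i mod q}"
      using \<phi>(2)[OF uv] by (auto simp: cycle_graph_def)
    then consider "\<phi> u = i" "\<phi> v = Suc i mod q" | "\<phi> v = i" "\<phi> u = Suc i mod q"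
      by (auto simp: doubleton_eq_iff)
    then show ?thesis
    proof cases
      case 1
      then show ?thesis using adj[of i] i fuv by auto
    next
      case 2
      then show ?thesis using adj[of i "f v" "f u"] i fuv by (simp add: insert_commute)
    qed
  qed
  define G' where "G' = (f ` verts H, {{f u, f v} | u v. {u, v} \<in> edges H})"
  have fG: "f ` verts H \<subseteq> verts G" using f(2) B \<phi>(1) by blast
  have "simple_graph G'"
    unfolding simple_graph_def
  proof (intro conjI ballI)
    show "finite (verts G')" using finH by (simp add: G'_def)
    fix e assume "e \<in> edges G'"
    then obtain u v where uv: "{u, v} \<in> edges H" "e = {f u, f v}" by (auto simp: G'_def)
    then have "u \<in> verts H" "v \<in> verts H" using edge_imp_verts[OF H(1)] by blast+
    then show "e \<subseteq> verts G'" using uv by (auto simp: G'_def)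
    show "card e = 2" using hom[OF uv(1)] uv(2) G by (auto simp: simple_graph_def)
  qed
  then have "subgraph G' G" using fG hom by (auto simp: subgraph_def G'_def)
  moreover have "isomorphic H G'"
    unfolding isomorphic_def
  proof (intro exI conjI ballI)
    show "bij_betw f (verts H) (verts G')" using f(1) by (simp add: bij_betw_def G'_def)
    fix u v assume uv: "u \<in> verts H" "v \<in> verts H"
    show "({u, v} \<in> edges H) = ({f u, f v} \<in> edges G')"
    proof
      assume "{f u, f v} \<in> edges G'"
      then obtain a b where ab: "{a, b} \<in> edges H" "{f u, f v} = {f a, f b}" by (auto simp: G'_def)
      then have "a \<in> verts H" "b \<in> verts H" using edge_imp_verts[OF H(1)] by blast+
      then have "{u, v} = {a, b}" using ab(2) uv f(1) by (auto simp: doubleton_eq_iff inj_on_eq_iff)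
      then show "{u, v} \<in> edges H" using ab by simp
    qed (auto simp: G'_def)
  qed
  ultimately show ?thesis unfolding free_of_def by blast
qed

text \<open>Otherwise the set of closed walks is dense enough to contain a box with sides of size
  \<open>card (verts H)\<close>, and hence \<open>G\<close> contains a copy of
  \<open>H\<close>.\<close>

lemma free_imp_few_closed_walks:
  assumes H: "simple_graph H" "verts H \<noteq> {}" "homomorphic H (cycle_graph q)" "q \<ge> 3" and "\<epsilon> > 0"
  shows "\<forall>\<^sub>F n in sequentially. \<forall>G :: 'b graph. simple_graph G \<and> card (verts G) = n \<and> free_of H G \<longrightarrow>
     real (card (closed_walks G q)) < \<epsilon> * real n ^ q"
proof -
  have "card (verts H) > 0" using H by (auto simp: simple_graph_def card_gt_0_iff)
  from dense_set_contains_box[OF \<open>\<epsilon> > 0\<close> this, of q, where 'a = 'b]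
  show ?thesis
  proof eventually_elim
    case (elim n)
    show ?case
    proof (intro allI impI, rule ccontr)
      fix G :: "'b graph"
      assume G: "simple_graph G \<and> card (verts G) = n \<and> free_of H G"
        and "\<not> real (card (closed_walks G q)) < \<epsilon> * real n ^ q"
      then have "real (card (closed_walks G q)) \<ge> \<epsilon> * real n ^ q" by simp
      moreover have "finite (verts G)" using G by (simp add: simple_graph_def)
      moreover have "closed_walks G q \<subseteq> {..<q} \<rightarrow>\<^sub>E verts G" by (auto simp: closed_walks_def)
      ultimately obtain B where "\<forall>i<q. B i \<subseteq> verts G \<and> card (B i) = card (verts H)"
        "PiE {..<q} B \<subseteq> closed_walks G q"
        using elim G by blast
      then show False using cycle_blowup_contains[OF H(1,3,4), of G B] G by blast
    qed
  qed
qed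

section \<open>Longer odd closed walks\<close>

lemma degree_eq_card_neighbours:
  assumes "simple_graph G"
  shows "degree G v = card {w \<in> verts G. {v, w} \<in> edges G}"
proof -
  have "{e \<in> edges G. v \<in> e} = (\<lambda>w. {v, w}) ` {w \<in> verts G. {v, w} \<in> edges G}"
  proof (intro equalityI subsetI)
    fix e assume e: "e \<in> {e \<in> edges G. v \<in> e}"
    then have "card e = 2" "e \<subseteq> verts G" using assms by (auto simp: simple_graph_def)
    then obtain a b where "e = {a, b}" by (auto simp: card_2_iff)
    then show "e \<in> (\<lambda>w. {v, w}) ` {w \<in> verts G. {v, w} \<in> edges G}"
      using e \<open>e \<subseteq> verts G\<close> by (auto simp: insert_commute)
  qed auto
  moreover have "inj_on (\<lambda>w. {v, w}) {w \<in> verts G. {v, w} \<in> edges G}"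
    by (auto simp: inj_on_def doubleton_eq_iff)
  ultimately show ?thesis unfolding degree_def by (simp add: card_image)
qed

text \<open>The three arcs between the points add up to the odd number \<open>l\<close>. If exactly
  one is odd, the two even ones have total length at least 4. If all are odd and the shortest
  exceeded \<open>l - 4\<close>, each would be at least \<open>l - 2\<close>, too long in total for
  \<open>l \<ge> 5\<close>. An odd arc of length \<open>p\<close> will be closed through a new
  vertex to an odd closed walk of length \<open>p + 2 < l\<close>.\<close>

lemma odd_arc_between_three_points:
  fixes a b c l :: nat
  assumes "odd l" "l \<ge> 5" "a < b" "b < c" "c < l"
  shows "\<exists>s p. s < l \<and> odd p \<and> p + 4 \<le> l \<and> s \<in> {a, b, c} \<and> (s + p) mod l \<in> {a, b, c}"
proof -
  obtain p where p: "b = a + p" "p > 0" using assms(3) by (metis less_imp_add_positive)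
  obtain q where q: "c = b + q" "q > 0" using assms(4) by (metis less_imp_add_positive)
  obtain r where r: "l + a = c + r" "r > 0"
    using assms by (metis less_imp_add_positive trans_less_add1)
  have sum: "p + q + r = l" using p q r by linarith
  have "(c + r) mod l = (l + a) mod l" using r(1) by simp
  then have m: "(a + p) mod l = b" "(b + q) mod l = c" "(c + r) mod l = a"
    using assms p(1) q(1) by auto
  have "odd p \<and> p + 4 \<le> l \<or> odd q \<and> q + 4 \<le> l \<or> odd r \<and> r + 4 \<le> l"
    using sum assms(1,2) p(2) q(2) r(2) by presburger
  moreover have "a < l" "b < l" using assms(3-5) by auto
  ultimately show ?thesis using m assms(5)
    by (elim disjE) (rule exI[of _ a] exI[of _ b] exI[of _ c], auto)+
qed

text \<open>The arc of \<open>p + 1\<close> walk vertices together with \<open>v\<close> is a closed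
  walk of length \<open>p + 2\<close>; the other \<open>l - (p + 1)\<close> vertices are bounded
  trivially.\<close>

lemma card_closed_walks_with_chord_path:
  assumes G: "simple_graph G" and s: "s < l" and p: "Suc p \<le> l"
  shows "card {(x, v) \<in> closed_walks G l \<times> verts G.
      {v, x s} \<in> edges G \<and> {v, x ((s + p) mod l)} \<in> edges G}
    \<le> card (closed_walks G (p + 2)) * card (verts G) ^ (l - Suc p)" (is "card ?P \<le> _")
proof -
  have fin: "finite (verts G)" using G by (simp add: simple_graph_def)
  \<comment> \<open>The pair is coded as one tuple of length \<open>l + 1\<close> with
    \<open>v\<close> at index \<open>l\<close>; nothing is lost, as \<open>x\<close> is
    \<open>undefined\<close> there.\<close>
  define X where "X = (\<lambda>(x, v). x(l := v)) ` ?P"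
  have inj: "inj_on (\<lambda>(x, v). x(l := v)) ?P"
  proof (rule inj_onI, clarsimp)
    fix x v y w assume xy: "x \<in> closed_walks G l" "y \<in> closed_walks G l" "x(l := v) = y(l := w)"
    have "x l = undefined" "y l = undefined"
      using xy(1,2) by (auto simp: closed_walks_def PiE_iff extensional_def)
    then show "x = y \<and> v = w" using xy(3) by (metis fun_upd_same fun_upd_triv fun_upd_upd)
  qed
  \<comment> \<open>The coordinates of the short walk: the arc from \<open>s\<close> to
    \<open>s + p\<close>, then the index \<open>l\<close> that carries \<open>v\<close>.\<close>
  define \<iota> where "\<iota> j = (if j = Suc p then l else (s + j) mod l)" for j
  have "card X \<le> card (closed_walks G (p + 2)) * card (verts G) ^ (card {..<Suc l} - card {..<p + 2})"
  proof (rule card_PiE_pullback_le[where \<iota> = \<iota>])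
    show "finite (verts G)" "finite (closed_walks G (p + 2))" "finite {..<Suc l}" using fin by auto
    have lt: "(s + j) mod l < l" for j using s by auto
    show "inj_on \<iota> {..<p + 2}"
    proof (rule inj_onI)
      fix i j assume ij: "i \<in> {..<p + 2}" "j \<in> {..<p + 2}" "\<iota> i = \<iota> j"
      show "i = j"
      proof (cases "i = Suc p \<or> j = Suc p")
        case True
        then show ?thesis using ij(3) lt[of i] lt[of j] unfolding \<iota>_def by (metis less_irrefl)
      next
        case False
        then have "(s + i) mod l = (s + j) mod l" "i < l" "j < l" using ij p by (auto simp: \<iota>_def)
        moreover have "(s + k) mod l = (if s + k < l then s + k else s + k - l)" if "k < l" for k
          using s that by (simp add: le_mod_geq)
        ultimately show ?thesis using s by (auto split: if_splits)
      qed
    qed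
    show "\<iota> ` {..<p + 2} \<subseteq> {..<Suc l}" using lt by (auto simp: \<iota>_def less_Suc_eq)
    show "X \<subseteq> {..<Suc l} \<rightarrow>\<^sub>E verts G"
      by (auto simp: X_def closed_walks_def PiE_iff extensional_def less_Suc_eq) metis
    fix z assume "z \<in> X"
    then obtain x v where xv: "z = x(l := v)" "x \<in> closed_walks G l" "v \<in> verts G"
      "{v, x s} \<in> edges G" "{v, x ((s + p) mod l)} \<in> edges G" by (auto simp: X_def)
    have xi: "z (\<iota> j) = (if j = Suc p then v else x ((s + j) mod l))" for j
      using lt[of j] by (auto simp: \<iota>_def xv(1))
    have xV: "x i \<in> verts G" "{x i, x (Suc i mod l)} \<in> edges G" if "i < l" for i
      using xv(2) that by (auto simp: closed_walks_def)
    show "(\<lambda>j\<in>{..<p + 2}. z (\<iota> j)) \<in> closed_walks G (p + 2)"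
      unfolding closed_walks_def
    proof (intro CollectI conjI allI impI)
      show "(\<lambda>j\<in>{..<p + 2}. z (\<iota> j)) \<in> {..<p + 2} \<rightarrow>\<^sub>E verts G"
        using xV lt xv(3) by (auto simp: xi)
      fix i assume i: "i < p + 2"
      consider "i = Suc p" | "i = p" | "i < p" using i by linarith
      then have "{z (\<iota> i), z (\<iota> (Suc i mod (p + 2)))} \<in> edges G"
      proof cases
        case 1
        then show ?thesis using xv(4) s by (simp add: xi)
      next
        case 2
        then show ?thesis using xv(5) by (simp add: xi insert_commute)
      next
        case 3
        then show ?thesis using xV(2)[OF lt[of i]] by (simp add: xi mod_Suc_eq)
      qed
      then show "{(\<lambda>j\<in>{..<p + 2}. z (\<iota> j)) i,
          (\<lambda>j\<in>{..<p + 2}. z (\<iota> j)) (Suc i mod (p + 2))} \<in> edges G"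
        using i by simp
    qed
  qed
  moreover have "card X = card ?P" unfolding X_def by (rule card_image[OF inj])
  ultimately show ?thesis by simp
qed

text \<open>Count the adjacencies between the positions of a walk and all vertices. Each walk has at
  least \<open>l * d\<close> of them, and a vertex contributes at most 2 unless it has three
  neighbours on the walk. In that case two of the three positions bound an odd arc that closes to a
  shorter odd walk, so such pairs are bounded by the shorter walk counts on the right.\<close>

lemma closed_walks_degree_count:
  fixes d :: real
  assumes G: "simple_graph G" and l: "odd l" "l \<ge> 5"
    and d: "\<And>v. v \<in> verts G \<Longrightarrow> d \<le> real (degree G v)"
  shows "(l * d - 2 * card (verts G)) * card (closed_walks G l) \<le>
    l * (\<Sum>s<l. \<Sum>p | odd p \<and> p + 4 \<le> l.
      card (closed_walks G (p + 2)) * card (verts G) ^ (l - Suc p))"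
proof -
  let ?V = "verts G" and ?W = "closed_walks G l"
  have fin: "finite ?V" "finite ?W" using G by (auto simp: simple_graph_def)
  \<comment> \<open>Positions are counted rather than vertices, so a repeated vertex of the walk
    counts with multiplicity, as in the sum of the degrees.\<close>
  define T where "T x v = {i. i < l \<and> {v, x i} \<in> edges G}" for x v
  have finT: "finite (T x v)" "card (T x v) \<le> l" for x v
    using card_mono[of "{..<l}" "T x v"] by (auto simp: T_def)
  define B where "B = {(x, v) \<in> ?W \<times> ?V. 3 \<le> card (T x v)}"
  define I where "I = {p. odd p \<and> p + 4 \<le> l}"
  have finI: "finite I" by (rule finite_subset[of _ "{..l}"]) (auto simp: I_def)
  define P where "P s p = {(x, v) \<in> ?W \<times> ?V. {v, x s} \<in> edges G \<and> {v, x ((s + p) mod l)} \<in> edges G}" for s p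
  have finP: "finite (P s p)" for s p
    by (rule finite_subset[of _ "?W \<times> ?V"]) (use fin in \<open>auto simp: P_def\<close>)
  have "B \<subseteq> (\<Union>s\<in>{..<l}. \<Union>p\<in>I. P s p)"
  proof clarify
    fix x v assume "(x, v) \<in> B"
    then have xv: "x \<in> ?W" "v \<in> ?V" "3 \<le> card (T x v)" by (auto simp: B_def)
    \<comment> \<open>Three ordered positions are obtained as minimum, maximum and any further
      element.\<close>
    define a where "a = Min (T x v)"
    define c where "c = Max (T x v)"
    have "T x v \<noteq> {}" using xv(3) by auto
    then have ac: "a \<in> T x v" "c \<in> T x v" using finT by (auto simp: a_def c_def)
    have "\<not> T x v \<subseteq> {a, c}"
    proof
      assume "T x v \<subseteq> {a, c}"
      then have "card (T x v) \<le> card {a, c}" by (intro card_mono) auto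
      also have "\<dots> \<le> 2" by (simp add: card_insert_if)
      finally show False using xv(3) by simp
    qed
    then obtain b where b: "b \<in> T x v" "b \<noteq> a" "b \<noteq> c" by auto
    then have "a \<le> b" "b \<le> c" using finT by (auto simp: a_def c_def)
    then have "a < b" "b < c" "c < l" using b ac by (auto simp: T_def)
    from odd_arc_between_three_points[OF l this] obtain s p where
      sp: "s < l" "odd p" "p + 4 \<le> l" "s \<in> {a, b, c}" "(s + p) mod l \<in> {a, b, c}" by blast
    then have "s \<in> T x v" "(s + p) mod l \<in> T x v" using ac b by auto
    then have "(x, v) \<in> P s p" using xv by (auto simp: P_def T_def)
    then show "(x, v) \<in> (\<Union>s\<in>{..<l}. \<Union>p\<in>I. P s p)" using sp by (auto simp: I_def)
  qed
  then have "card B \<le> card (\<Union>s\<in>{..<l}. \<Union>p\<in>I. P s p)"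
    using finP finI by (intro card_mono) auto
  also have "\<dots> \<le> (\<Sum>s<l. card (\<Union>p\<in>I. P s p))" by (rule card_UN_le) simp
  also have "\<dots> \<le> (\<Sum>s<l. \<Sum>p\<in>I. card (P s p))" by (intro sum_mono card_UN_le finI)
  also have "\<dots> \<le> (\<Sum>s<l. \<Sum>p\<in>I. card (closed_walks G (p + 2)) * card ?V ^ (l - Suc p))"
    unfolding P_def by (intro sum_mono card_closed_walks_with_chord_path G) (auto simp: I_def)
  finally have cB: "card B \<le> (\<Sum>s<l. \<Sum>p\<in>I. card (closed_walks G (p + 2)) * card ?V ^ (l - Suc p))" .
  have deg: "(\<Sum>v\<in>?V. card (T x v)) = (\<Sum>i<l. degree G (x i))" for x
  proof -
    have "(\<Sum>v\<in>?V. card (T x v)) = (\<Sum>v\<in>?V. \<Sum>i<l. if {v, x i} \<in> edges G then 1 else 0)"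
      by (simp add: T_def sum.If_cases Int_def)
    also have "\<dots> = (\<Sum>i<l. \<Sum>v\<in>?V. if {v, x i} \<in> edges G then 1 else 0)" by (rule sum.swap)
    also have "\<dots> = (\<Sum>i<l. degree G (x i))"
      using fin G by (simp add: degree_eq_card_neighbours sum.If_cases Int_def insert_commute)
    finally show ?thesis .
  qed
  have "card ?W * (l * d) = (\<Sum>x\<in>?W. \<Sum>i<l. d)" by simp
  also have "\<dots> \<le> (\<Sum>x\<in>?W. \<Sum>i<l. real (degree G (x i)))"
    using d by (intro sum_mono) (auto simp: closed_walks_def)
  also have "\<dots> = (\<Sum>x\<in>?W. \<Sum>v\<in>?V. real (card (T x v)))"
    by (simp add: deg flip: of_nat_sum)
  also have "\<dots> \<le> (\<Sum>x\<in>?W. \<Sum>v\<in>?V. 2 + (if (x, v) \<in> B then real l else 0))"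
  proof (intro sum_mono)
    fix x v assume "x \<in> ?W" "v \<in> ?V"
    then show "real (card (T x v)) \<le> 2 + (if (x, v) \<in> B then real l else 0)"
      using finT(2)[of x v] by (auto simp: B_def)
  qed
  also have "\<dots> = (\<Sum>xv\<in>?W \<times> ?V. 2 + (if xv \<in> B then real l else 0))"
    by (simp add: sum.cartesian_product)
  also have "\<dots> = 2 * (card ?W * card ?V) + card B * l"
  proof -
    have "(?W \<times> ?V) \<inter> B = B" by (auto simp: B_def)
    then show ?thesis using fin by (simp add: sum.distrib sum.If_cases)
  qed
  finally have "card ?W * (l * d) \<le> 2 * (card ?W * card ?V) + card B * l" by simp
  moreover have "real (card B * l) \<le> real ((\<Sum>s<l. \<Sum>p\<in>I. card (closed_walks G (p + 2)) * card ?V ^ (l - Suc p)) * l)"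
    using cB by (intro of_nat_mono mult_right_mono) auto
  ultimately show ?thesis unfolding I_def by (simp add: algebra_simps)
qed

text \<open>The number of closed walks of length \<open>l\<close> is \<open>o(n ^ l)\<close>,
  uniformly over the class of graphs \<open>G\<close> with \<open>\<G> n G\<close>.\<close>

definition few_closed_walks :: "(nat \<Rightarrow> 'a graph \<Rightarrow> bool) \<Rightarrow> nat \<Rightarrow> bool" where
  "few_closed_walks \<G> l \<longleftrightarrow>
     (\<forall>\<epsilon>>0. \<forall>\<^sub>F n in sequentially. \<forall>G. \<G> n G \<longrightarrow> real (card (closed_walks G l)) < \<epsilon> * real n ^ l)"

text \<open>In the degree count the left side is \<open>(l * c - 2) * n\<close> times the number of
  walks, with a positive factor, while the right side involves only odd lengths from 3 to
  \<open>l - 2\<close> and is \<open>o(n ^ (l + 1))\<close> by induction.\<close>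

lemma few_closed_walks_step:
  assumes \<G>: "\<And>n G. \<G> n G \<Longrightarrow> simple_graph G \<and> card (verts G) = n"
    and deg: "\<And>n G v. \<G> n G \<Longrightarrow> v \<in> verts G \<Longrightarrow> c * real n \<le> real (degree G v)"
    and l: "odd l" "l \<ge> 5" "l * c > 2"
    and IH: "\<And>j. odd j \<Longrightarrow> 3 \<le> j \<Longrightarrow> j < l \<Longrightarrow> few_closed_walks \<G> j"
  shows "few_closed_walks \<G> l"
  unfolding few_closed_walks_def
proof (intro allI impI)
  fix \<epsilon> :: real assume "\<epsilon> > 0"
  \<comment> \<open>The right side has at most \<open>l ^ 2\<close> summands and an outer factor
    \<open>l\<close>; the factor \<open>l ^ 3\<close> cancels, and the 2 leaves room for strict
    inequality.\<close>
  define \<delta> where "\<delta> = \<epsilon> * (l * c - 2) / (2 * l ^ 3)"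
  define I where "I = {p. odd p \<and> p + 4 \<le> l}"
  have finI: "finite I" "card I \<le> l"
  proof -
    have "I \<subseteq> {..<l}" by (auto simp: I_def)
    then show "finite I" "card I \<le> l" using card_mono[of "{..<l}" I] finite_subset by auto
  qed
  have "\<delta> > 0" using l \<open>\<epsilon> > 0\<close> by (simp add: \<delta>_def)
  have "\<forall>p\<in>I. \<forall>\<^sub>F n in sequentially. \<forall>G. \<G> n G \<longrightarrow>
      real (card (closed_walks G (p + 2))) < \<delta> * real n ^ (p + 2)"
  proof
    fix p assume "p \<in> I"
    then have "few_closed_walks \<G> (p + 2)"
      by (intro IH) (auto simp: I_def elim: oddE)
    then show "\<forall>\<^sub>F n in sequentially. \<forall>G. \<G> n G \<longrightarrow>
      real (card (closed_walks G (p + 2))) < \<delta> * real n ^ (p + 2)"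
      using \<open>\<delta> > 0\<close> unfolding few_closed_walks_def by blast
  qed
  then have "\<forall>\<^sub>F n in sequentially. \<forall>p\<in>I. \<forall>G. \<G> n G \<longrightarrow>
      real (card (closed_walks G (p + 2))) < \<delta> * real n ^ (p + 2)"
    by (rule eventually_ball_finite[OF finI(1)])
  moreover have "\<forall>\<^sub>F n in sequentially. n \<ge> (1 :: nat)" by (rule eventually_ge_at_top)
  ultimately show "\<forall>\<^sub>F n in sequentially. \<forall>G. \<G> n G \<longrightarrow> real (card (closed_walks G l)) < \<epsilon> * real n ^ l"
  proof eventually_elim
    case (elim n)
    show ?case
    proof (intro allI impI)
      fix G assume G: "\<G> n G"
      let ?w = "real (card (closed_walks G l))"
      have sG: "simple_graph G" "card (verts G) = n" using \<G>[OF G] by auto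
      have "(l * (c * n) - 2 * n) * ?w \<le>
         l * real (\<Sum>s<l. \<Sum>p\<in>I. card (closed_walks G (p + 2)) * n ^ (l - Suc p))"
        using closed_walks_degree_count[OF sG(1) l(1,2), of "c * n"] deg[OF G] sG(2)
        unfolding I_def by simp
      also have "\<dots> = l * (\<Sum>s<l. \<Sum>p\<in>I. real (card (closed_walks G (p + 2))) * real n ^ (l - Suc p))"
        by simp
      also have "\<dots> \<le> l * (\<Sum>s<l. \<Sum>p\<in>I. \<delta> * real n ^ Suc l)"
      proof (intro mult_left_mono sum_mono)
        fix p assume p: "p \<in> I"
        have "real (card (closed_walks G (p + 2))) < \<delta> * real n ^ (p + 2)"
          using elim(1) p G by blast
        then have "real (card (closed_walks G (p + 2))) * real n ^ (l - Suc p)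
            \<le> (\<delta> * real n ^ (p + 2)) * real n ^ (l - Suc p)"
          by (intro mult_right_mono) auto
        also have "\<dots> = \<delta> * real n ^ (p + 2 + (l - Suc p))" by (simp add: power_add)
        also have "p + 2 + (l - Suc p) = Suc l" using p by (auto simp: I_def)
        finally show "real (card (closed_walks G (p + 2))) * real n ^ (l - Suc p) \<le> \<delta> * real n ^ Suc l" .
      qed auto
      also have "\<dots> = l * (l * (card I * (\<delta> * real n ^ Suc l)))" by simp
      also have "\<dots> \<le> l * (l * (l * (\<delta> * real n ^ Suc l)))"
        using finI(2) \<open>\<delta> > 0\<close> by (intro mult_left_mono mult_right_mono) auto
      also have "\<dots> = (l * c - 2) * n * (\<epsilon> / 2 * real n ^ l)"
        using l(2) by (simp add: \<delta>_def field_simps power3_eq_cube)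
      finally have "((l * c - 2) * n) * ?w \<le> ((l * c - 2) * n) * (\<epsilon> / 2 * real n ^ l)"
        by (simp add: algebra_simps)
      moreover have "(l * c - 2) * n > 0" using l(3) elim(2) by simp
      ultimately have "?w \<le> \<epsilon> / 2 * real n ^ l" by (rule mult_left_le_imp_le)
      also have "\<dots> < \<epsilon> * real n ^ l" using \<open>\<epsilon> > 0\<close> elim(2) by simp
      finally show "?w < \<epsilon> * real n ^ l" .
    qed
  qed
qed

section \<open>Graphs far from bipartite\<close>

text \<open>Without odd closed walks, the parity of walks from a representative of each component
  would be a proper colouring. A shortest odd closed walk repeats no vertex, since a repetition
  splits it into two closed walks, one of which is odd and shorter. Loops are allowed and give
  \<open>l = 1\<close>.\<close>

lemma odd_cycle_if_not_two_colourable: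
  fixes R :: "('a \<times> 'a) set"
  assumes "sym R" and col: "\<And>\<chi> :: 'a \<Rightarrow> bool. \<exists>(u, v)\<in>R. \<chi> u = \<chi> v"
  shows "\<exists>l f. odd l \<and> inj_on f {..<l} \<and> (\<forall>i<l. (f i, f (Suc i mod l)) \<in> R)"
proof -
  have symp: "(v, u) \<in> R ^^ k" if "(u, v) \<in> R ^^ k" for u v k
    using that \<open>sym R\<close>
  proof (induction k arbitrary: v)
    case (Suc k)
    then obtain w where "(u, w) \<in> R ^^ k" "(w, v) \<in> R" by auto
    then show ?case using Suc by (meson relpow_Suc_I2 symD)
  qed auto
  have "\<exists>l. odd l \<and> (\<exists>u. (u, u) \<in> R ^^ l)"
  proof (rule ccontr)
    assume no: "\<not> ?thesis"
    \<comment> \<open>The choice depends only on the set of \<open>r\<close> that reach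
      \<open>u\<close>, hence is the same for all vertices of a component.\<close>
    define rep where "rep u = (SOME r. (r, u) \<in> R\<^sup>*)" for u
    have rep: "(rep u, u) \<in> R\<^sup>*" for u unfolding rep_def by (rule someI[of _ u]) simp
    define \<chi> where "\<chi> u \<longleftrightarrow> (\<exists>k. even k \<and> (rep u, u) \<in> R ^^ k)" for u
    obtain u v where uv: "(u, v) \<in> R" "\<chi> u = \<chi> v" using col[of \<chi>] by blast
    have "(r, u) \<in> R\<^sup>* \<longleftrightarrow> (r, v) \<in> R\<^sup>*" for r
      using uv(1) \<open>sym R\<close> by (meson rtrancl.rtrancl_into_rtrancl symD)
    then have req: "rep u = rep v" by (simp add: rep_def)
    obtain k m where km: "(rep u, u) \<in> R ^^ k" "(rep u, v) \<in> R ^^ m" "even k \<longleftrightarrow> even m"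
    proof (cases "\<chi> u")
      case True
      then show ?thesis using that uv(2) req unfolding \<chi>_def by metis
    next
      case False
      moreover obtain k m where "(rep u, u) \<in> R ^^ k" "(rep v, v) \<in> R ^^ m"
        using rep rtrancl_imp_relpow by metis
      ultimately show ?thesis using that uv(2) req unfolding \<chi>_def by metis
    qed
    have "(rep u, v) \<in> R ^^ Suc k" using km(1) uv(1) by auto
    then have "(rep u, rep u) \<in> R ^^ (Suc k + m)"
      using symp[OF km(2)] by (auto simp only: relpow_add)
    then show False using no km(3) by (metis even_Suc even_add)
  qed
  then obtain l where l: "odd l" "\<exists>u. (u, u) \<in> R ^^ l"
    and least: "\<And>m u. odd m \<Longrightarrow> (u, u) \<in> R ^^ m \<Longrightarrow> l \<le> m"
    using exists_least_iff[of "\<lambda>l. odd l \<and> (\<exists>u. (u, u) \<in> R ^^ l)"] by (metis not_less)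
  from l(2) obtain f where "f 0 = f l \<and> (\<forall>i<l. (f i, f (Suc i)) \<in> R)"
    unfolding relpow_fun_conv by metis
  then have f: "f 0 = f l" "\<And>i. i < l \<Longrightarrow> (f i, f (Suc i)) \<in> R" by auto
  have path: "(f i, f (i + d)) \<in> R ^^ d" if "i + d \<le> l" for i d
    using that f(2) by (intro relpow_fun_conv[THEN iffD2] exI[of _ "\<lambda>k. f (i + k)"]) auto
  have "inj_on f {..<l}"
  proof (rule linorder_inj_onI)
    fix i j assume ij: "i < j" "i \<in> {..<l}" "j \<in> {..<l}"
    show "f i \<noteq> f j"
    proof
      assume eq: "f i = f j"
      have "(f i, f i) \<in> R ^^ (j - i)" using path[of i "j - i"] ij eq by simp
      moreover have "(f i, f i) \<in> R ^^ ((l - j) + i)"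
        unfolding relpow_add using path[of j "l - j"] path[of 0 i] ij eq f(1)
        by (intro relcompI[of _ "f l"]) auto
      moreover have "odd (j - i) \<or> odd ((l - j) + i)" using l(1) ij by auto
      ultimately have "l \<le> j - i \<or> l \<le> (l - j) + i" using least by blast
      then show False using ij by auto
    qed
  qed auto
  moreover have "(f i, f (Suc i mod l)) \<in> R" if "i < l" for i
    using f(2)[OF that] f(1) that by (cases "Suc i = l") auto
  ultimately show ?thesis using l(1) by blast
qed

text \<open>A walk of length 3 from \<open>a\<close> to \<open>b\<close> is recorded by its ordered
  pair of inner vertices; \<open>a = b\<close> is allowed and gives closed walks.\<close>

definition three_walks :: "'a graph \<Rightarrow> 'a \<Rightarrow> 'a \<Rightarrow> ('a \<times> 'a) set" where
  "three_walks G a b = {(x, y). {a, x} \<in> edges G \<and> {x, y} \<in> edges G \<and> {y, b} \<in> edges G}"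

lemma three_walks_subset: "simple_graph G \<Longrightarrow> three_walks G a b \<subseteq> verts G \<times> verts G"
  by (auto simp: three_walks_def dest: edge_imp_verts)

lemma finite_three_walks: "simple_graph G \<Longrightarrow> finite (three_walks G a b)"
  by (rule finite_subset[OF three_walks_subset]) (auto simp: simple_graph_def)

lemma card_three_walks_commute: "card (three_walks G a b) = card (three_walks G b a)"
proof -
  have "three_walks G b a = prod.swap ` three_walks G a b"
    by (auto simp: three_walks_def insert_commute image_iff)
  then show ?thesis by (simp add: card_image)
qed

text \<open>Replacing each step of the cyclic tuple \<open>y\<close> by a walk of length 3 gives a
  closed walk of length \<open>3 * q\<close>. There are at least \<open>m\<close> choices for each
  of the \<open>q\<close> steps, and the result determines \<open>y\<close> and all choices.\<close>

lemma card_closed_walks_triple_ge: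
  fixes m :: real and q :: nat
  assumes G: "simple_graph G" and "m \<ge> 0"
  defines "Y \<equiv> {y \<in> {..<q} \<rightarrow>\<^sub>E verts G. \<forall>j<q. m \<le> card (three_walks G (y j) (y (Suc j mod q)))}"
  shows "card Y * m ^ q \<le> card (closed_walks G (3 * q))"
proof -
  have fin: "finite (verts G)" using G by (simp add: simple_graph_def)
  have finY: "finite Y" by (rule finite_subset[of _ "{..<q} \<rightarrow>\<^sub>E verts G"])
    (auto simp: Y_def fin intro: finite_PiE)
  define Z where "Z y = PiE {..<q} (\<lambda>j. three_walks G (y j) (y (Suc j mod q)))" for y
  have finZ: "finite (Z y)" for y
    unfolding Z_def by (intro finite_PiE finite_three_walks G) auto
  \<comment> \<open>The entries of \<open>y\<close> stand at the multiples of 3, each followed by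
    the two inner vertices of its step.\<close>
  define F where "F = (\<lambda>(y, z). \<lambda>i\<in>{..<3 * q}. if i mod 3 = 0 then y (i div 3)
    else if i mod 3 = 1 then fst (z (i div 3) :: 'a \<times> 'a) else snd (z (i div 3)))"
  have F: "F (y, z) (3 * j) = y j" "F (y, z) (3 * j + 1) = fst (z j)" "F (y, z) (3 * j + 2) = snd (z j)"
    if "j < q" for y z j
  proof -
    have "F (y, z) (3 * j + r) = (if r = 0 then y j else if r = 1 then fst (z j) else snd (z j))"
      if "r < 3" for r
    proof -
      have "(3 * j + r) div 3 = j" "(3 * j + r) mod 3 = r" "3 * j + r < 3 * q"
        using that \<open>j < q\<close> by auto
      then show ?thesis
        unfolding F_def by (simp only: case_prod_conv restrict_apply lessThan_iff if_True)
    qed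
    from this[of 0] this[of 1] this[of 2]
    show "F (y, z) (3 * j) = y j" "F (y, z) (3 * j + 1) = fst (z j)" "F (y, z) (3 * j + 2) = snd (z j)"
      by simp_all
  qed
  have inj: "inj_on F (Sigma Y Z)"
  proof (rule inj_onI, clarify)
    fix y z y' z' assume yz: "y \<in> Y" "z \<in> Z y" "y' \<in> Y" "z' \<in> Z y'" "F (y, z) = F (y', z')"
    have "y j = y' j" "z j = z' j" if "j < q" for j
      using F[OF that, of y z] F[OF that, of y' z'] yz(5) by (auto simp: prod_eq_iff)
    moreover have "y \<in> extensional {..<q}" "y' \<in> extensional {..<q}"
      "z \<in> extensional {..<q}" "z' \<in> extensional {..<q}"
      using yz by (auto simp: Y_def Z_def PiE_iff)
    ultimately show "y = y' \<and> z = z'" by (auto intro!: extensionalityI[of _ "{..<q}"])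
  qed
  have sub: "F ` Sigma Y Z \<subseteq> closed_walks G (3 * q)"
  proof clarify
    fix y z assume y: "y \<in> Y" and z: "z \<in> Z y"
    have yV: "y j \<in> verts G" if "j < q" for j using y that by (auto simp: Y_def)
    have zT: "{y j, fst (z j)} \<in> edges G" "{fst (z j), snd (z j)} \<in> edges G"
      "{snd (z j), y (Suc j mod q)} \<in> edges G" if "j < q" for j
      using PiE_mem[OF z[unfolded Z_def], of j] that by (auto simp: three_walks_def)
    have E: "{F (y, z) i, F (y, z) (Suc i mod (3 * q))} \<in> edges G" if i: "i < 3 * q" for i
    proof -
      define j where "j = i div 3"
      have j: "j < q" using i by (auto simp: j_def)
      consider "i = 3 * j" | "i = 3 * j + 1" | "i = 3 * j + 2" unfolding j_def by linarith
      then show ?thesis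
      proof cases
        case 1
        then have "Suc i mod (3 * q) = 3 * j + 1" using j by simp
        then show ?thesis using zT(1)[OF j] F[OF j, of y z] 1 by simp
      next
        case 2
        then have "Suc i mod (3 * q) = 3 * j + 2" using j by simp
        then show ?thesis using zT(2)[OF j] F[OF j, of y z] 2 by simp
      next
        case 3
        then have "Suc i = 3 * Suc j" by simp
        then have "Suc i mod (3 * q) = 3 * (Suc j mod q)" by (simp only: mult_mod_right)
        moreover have "Suc j mod q < q" using j by simp
        ultimately show ?thesis using zT(3)[OF j] F[OF j, of y z] F(1)[of "Suc j mod q" y z] 3 by simp
      qed
    qed
    moreover have "F (y, z) \<in> extensional {..<3 * q}" by (simp add: F_def)
    then have "F (y, z) \<in> {..<3 * q} \<rightarrow>\<^sub>E verts G"
      using edge_imp_verts(1)[OF G E] by (simp add: PiE_iff)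
    ultimately show "F (y, z) \<in> closed_walks G (3 * q)" by (simp add: closed_walks_def)
  qed
  have "card Y * m ^ q = (\<Sum>y\<in>Y. \<Prod>j<q. m)" by simp
  also have "\<dots> \<le> (\<Sum>y\<in>Y. \<Prod>j<q. real (card (three_walks G (y j) (y (Suc j mod q)))))"
    using \<open>m \<ge> 0\<close> by (intro sum_mono prod_mono) (auto simp: Y_def)
  also have "\<dots> = (\<Sum>y\<in>Y. real (card (Z y)))"
    by (simp add: Z_def card_PiE)
  also have "\<dots> = card (Sigma Y Z)" using finY finZ by (simp add: card_SigmaI)
  also have "\<dots> \<le> card (closed_walks G (3 * q))"
    using card_inj_on_le[OF inj sub] fin by simp
  finally show ?thesis .
qed

text \<open>Colour a random sample \<open>s\<close> of \<open>t\<close> vertices arbitrarily and give every other vertex the colour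
  opposite to its first neighbour in the sample. In a graph far from bipartite each such colouring has
  many monochromatic edges, and each of them closes a walk of length 3 between two sample vertices
  of equal colour. So the relation ``joined by many walks of length 3'' on the sample is not
  2-colourable, and an odd cycle of length \<open>q\<close> in it yields many closed walks of length \<open>3 q\<close>.\<close>

lemma far_from_bipartite_imp_closed_walks:
  fixes G :: "'a graph" and c \<eta> :: real and t :: nat
  defines "n \<equiv> card (verts G)" and "\<beta> \<equiv> \<eta> / (2 * t ^ 2)"
  assumes G: "simple_graph G" and n: "n > 0" and t: "t > 0" "\<eta> > 0" "(1 - c) ^ t \<le> \<eta> / 4"
    and deg: "\<And>v. v \<in> verts G \<Longrightarrow> c * n \<le> degree G v"
    and far: "\<And>D. D \<subseteq> edges G \<Longrightarrow> card D \<le> \<eta> * n ^ 2 \<Longrightarrow> \<not> partite 2 (verts G, edges G - D)"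
  shows "real n ^ t / 2 \<le> (\<Sum>q | odd q \<and> q \<le> t.
    t ^ q * (card (closed_walks G (3 * q)) / (\<beta> * n ^ 2) ^ q * real n ^ (t - q)))"
proof -
  let ?V = "verts G" and ?E = "edges G"
  have fin: "finite ?V" using G by (simp add: simple_graph_def)
  define S where "S = {..<t} \<rightarrow>\<^sub>E ?V"
  have finS: "finite S" and cS: "card S = n ^ t"
    using fin by (auto simp: S_def n_def card_PiE intro: finite_PiE)
  \<comment> \<open>The vertices without a neighbour in the sample \<open>s\<close>; the good
    samples \<open>A\<close> are those that leave few of them.\<close>
  define U where "U s = {v \<in> ?V. \<forall>i<t. {v, s i} \<notin> ?E}" for s
  have finU: "finite (U s)" for s using fin by (simp add: U_def)
  define A where "A = {s \<in> S. card (U s) \<le> \<eta> / 2 * n}"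
  have A: "A \<subseteq> S" "finite A" using finS by (auto simp: A_def)

  \<comment> \<open>Most samples leave few vertices without a neighbour\<close>
  have "(\<Sum>s\<in>S. card (U s)) = (\<Sum>s\<in>S. \<Sum>v\<in>?V. if \<forall>i<t. {v, s i} \<notin> ?E then 1 else 0)"
    using fin by (simp add: U_def sum.If_cases Int_def)
  also have "\<dots> = (\<Sum>v\<in>?V. \<Sum>s\<in>S. if \<forall>i<t. {v, s i} \<notin> ?E then 1 else 0)" by (rule sum.swap)
  also have "\<dots> = (\<Sum>v\<in>?V. card {s \<in> S. \<forall>i<t. {v, s i} \<notin> ?E})"
    using finS by (simp add: sum.If_cases Int_def)
  also have "\<dots> = (\<Sum>v\<in>?V. (n - degree G v) ^ t)"
  proof (rule sum.cong[OF refl])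
    fix v
    have "{s \<in> S. \<forall>i<t. {v, s i} \<notin> ?E} = {..<t} \<rightarrow>\<^sub>E {w \<in> ?V. {v, w} \<notin> ?E}"
    proof (rule set_eqI)
      fix s
      show "s \<in> {s \<in> S. \<forall>i<t. {v, s i} \<notin> ?E} \<longleftrightarrow> s \<in> {..<t} \<rightarrow>\<^sub>E {w \<in> ?V. {v, w} \<notin> ?E}"
        unfolding S_def PiE_iff mem_Collect_eq Ball_def lessThan_iff by iprover
    qed
    moreover have "card {w \<in> ?V. {v, w} \<notin> ?E} = n - degree G v"
    proof -
      have "card {w \<in> ?V. {v, w} \<notin> ?E} = card (?V - {w \<in> ?V. {v, w} \<in> ?E})"
        by (rule arg_cong[of _ _ card]) auto
      also have "\<dots> = card ?V - card {w \<in> ?V. {v, w} \<in> ?E}"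
        using fin by (intro card_Diff_subset) auto
      finally show ?thesis unfolding degree_eq_card_neighbours[OF G] n_def .
    qed
    ultimately show "card {s \<in> S. \<forall>i<t. {v, s i} \<notin> ?E} = (n - degree G v) ^ t"
      by (simp only: card_PiE finite_lessThan prod_constant card_lessThan)
  qed
  finally have sumU: "(\<Sum>s\<in>S. card (U s)) = (\<Sum>v\<in>?V. (n - degree G v) ^ t)" .
  have "real (\<Sum>s\<in>S. card (U s)) = (\<Sum>v\<in>?V. real (n - degree G v) ^ t)"
    unfolding sumU by simp
  also have "\<dots> \<le> (\<Sum>v\<in>?V. ((1 - c) * n) ^ t)"
  proof (intro sum_mono power_mono)
    fix v assume v: "v \<in> ?V"
    have "degree G v \<le> n" unfolding degree_eq_card_neighbours[OF G] n_def
      using fin by (intro card_mono) auto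
    then show "real (n - degree G v) \<le> (1 - c) * n" using deg[OF v] by (simp add: of_nat_diff algebra_simps)
  qed auto
  also have "\<dots> = n * ((1 - c) ^ t * n ^ t)" by (simp add: power_mult_distrib n_def)
  also have "\<dots> \<le> n * (\<eta> / 4 * n ^ t)" using t by (intro mult_left_mono mult_right_mono) auto
  finally have sumU_le: "real (\<Sum>s\<in>S. card (U s)) \<le> n * (\<eta> / 4 * n ^ t)" by simp
  \<comment> \<open>Markov's inequality: the average of \<open>card (U s)\<close> is at most
    \<open>\<eta> / 4 * n\<close>, so at most half of the samples exceed twice that bound.\<close>
  have "card (S - A) * (\<eta> / 2 * n) = (\<Sum>s\<in>S - A. \<eta> / 2 * n)" by simp
  also have "\<dots> \<le> (\<Sum>s\<in>S - A. real (card (U s)))" by (intro sum_mono) (auto simp: A_def)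
  also have "\<dots> \<le> (\<Sum>s\<in>S. real (card (U s)))" using finS by (intro sum_mono2) auto
  also have "\<dots> \<le> (real n ^ t / 2) * (\<eta> / 2 * n)" using sumU_le by (simp add: algebra_simps)
  finally have "card (S - A) \<le> real n ^ t / 2"
    using n t by (subst (asm) mult_le_cancel_right_pos) auto
  moreover have "real (card (S - A)) = real n ^ t - card A"
    using A card_mono[OF finS A(1)] cS by (simp add: card_Diff_subset of_nat_diff)
  ultimately have cA: "real n ^ t / 2 \<le> card A" by simp

  \<comment> \<open>The relation on a good sample is not 2-colourable\<close>
  have \<beta>: "\<beta> > 0" using t by (simp add: \<beta>_def)
  define R where "R s = {(i, j). i < t \<and> j < t \<and> \<beta> * n ^ 2 \<le> card (three_walks G (s i) (s j))}" for s
  have symR: "sym (R s)" for s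
  proof (rule symI)
    fix i j assume "(i, j) \<in> R s"
    then show "(j, i) \<in> R s" using card_three_walks_commute[of G "s i" "s j"] by (simp add: R_def)
  qed
  have colR: "\<exists>(i, j)\<in>R s. \<chi> i = \<chi> j" if s: "s \<in> A" for s and \<chi> :: "nat \<Rightarrow> bool"
  proof (rule ccontr)
    assume "\<not> ?thesis"
    then have small: "card (three_walks G (s i) (s j)) \<le> \<beta> * n ^ 2" if "i < t" "j < t" "\<chi> i = \<chi> j" for i j
      using that by (force simp: R_def)
    \<comment> \<open>First sample neighbour; its value on \<open>U s\<close> is irrelevant because
      edges meeting \<open>U s\<close> are counted separately. The colouring \<open>f\<close> copies
      the colour of this neighbour: exchanging the two colours does not affect which edges are
      monochromatic.\<close>
    define fn where "fn v = (LEAST i. i < t \<and> {v, s i} \<in> ?E)" for v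
    have fn: "fn v < t \<and> {v, s (fn v)} \<in> ?E" if "v \<in> ?V" "v \<notin> U s" for v
      unfolding fn_def by (rule LeastI_ex) (use that in \<open>auto simp: U_def\<close>)
    define f where "f v = (if \<chi> (fn v) then 1 else 0 :: nat)" for v
    define D where "D = {e \<in> ?E. \<exists>u v. e = {u, v} \<and> f u = f v}"
    have "partite 2 (?V, ?E - D)" unfolding partite_def D_def
      by (intro exI[of _ f]) (auto simp: f_def)
    then have cD: "card D > \<eta> * n ^ 2" using far[of D] by (force simp: D_def)
    define M where "M = {(i, j). i < t \<and> j < t \<and> \<chi> i = \<chi> j}"
    have M: "M \<subseteq> {..<t} \<times> {..<t}" "finite M"
      using finite_subset[of M "{..<t} \<times> {..<t}"] by (auto simp: M_def)
    \<comment> \<open>Monochromatic edges that meet \<open>U s\<close> lie in \<open>D1\<close>. Any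
      other one, \<open>u v\<close>, is the middle of a walk of length 3 between the first sample
      neighbours of \<open>u\<close> and \<open>v\<close>, which have equal colour, and lies in
      \<open>D2\<close>. These neighbours may coincide, so \<open>M\<close> contains the diagonal.
      Each set has at most half of the size allowed.\<close>
    define D1 where "D1 = (\<lambda>(u, w). {u, w}) ` (U s \<times> ?V)"
    define D2 where "D2 = (\<Union>(i, j)\<in>M. (\<lambda>(x, y). {x, y}) ` three_walks G (s i) (s j))"
    have "D \<subseteq> D1 \<union> D2"
    proof
      fix e assume "e \<in> D"
      then obtain u v where e: "e = {u, v}" "f u = f v" "{u, v} \<in> ?E" by (auto simp: D_def)
      then have V: "u \<in> ?V" "v \<in> ?V" using edge_imp_verts[OF G] by blast+
      show "e \<in> D1 \<union> D2"
      proof (cases "u \<in> U s \<or> v \<in> U s")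
        case True
        then have "(u, v) \<in> U s \<times> ?V \<or> (v, u) \<in> U s \<times> ?V" using V by auto
        then have "e \<in> D1" unfolding D1_def e(1) by (elim disjE) (erule rev_image_eqI, auto)+
        then show ?thesis by blast
      next
        case False
        then have "fn u < t" "{u, s (fn u)} \<in> ?E" "fn v < t" "{v, s (fn v)} \<in> ?E" using fn V by auto
        moreover have "\<chi> (fn u) = \<chi> (fn v)" using e(2) by (auto simp: f_def split: if_splits)
        ultimately have "(fn u, fn v) \<in> M" "(u, v) \<in> three_walks G (s (fn u)) (s (fn v))"
          using e(3) by (auto simp: M_def three_walks_def insert_commute)
        then show ?thesis unfolding D2_def e(1) by force
      qed
    qed
    moreover have "finite D1" "finite D2"
      using finU fin M finite_three_walks[OF G] by (auto simp: D1_def D2_def)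
    ultimately have "card D \<le> card D1 + card D2"
      by (meson card_Un_le card_mono finite_UnI le_trans)
    moreover have "real (card D1) \<le> \<eta> / 2 * n ^ 2"
    proof -
      have "card D1 \<le> card (U s \<times> ?V)" unfolding D1_def using finU fin by (intro card_image_le) auto
      then have "real (card D1) \<le> real (card (U s)) * real n"
        by (simp add: n_def card_cartesian_product flip: of_nat_mult)
      also have "\<dots> \<le> (\<eta> / 2 * n) * n" using s by (intro mult_right_mono) (auto simp: A_def)
      finally show ?thesis by (simp add: power2_eq_square)
    qed
    moreover have "real (card D2) \<le> \<eta> / 2 * n ^ 2"
    proof -
      have "card D2 \<le> (\<Sum>m\<in>M. card (case m of (i, j) \<Rightarrow> (\<lambda>(x, y). {x, y}) ` three_walks G (s i) (s j)))"
        unfolding D2_def by (rule card_UN_le[OF M(2)])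
      also have "\<dots> \<le> (\<Sum>(i, j)\<in>M. card (three_walks G (s i) (s j)))"
        by (intro sum_mono) (auto intro: card_image_le finite_three_walks[OF G])
      finally have "real (card D2) \<le> (\<Sum>(i, j)\<in>M. real (card (three_walks G (s i) (s j))))"
        by (simp add: case_prod_unfold flip: of_nat_sum)
      also have "\<dots> \<le> (\<Sum>(i, j)\<in>M. \<beta> * n ^ 2)"
        using small by (intro sum_mono) (auto simp: M_def)
      also have "\<dots> = card M * (\<beta> * n ^ 2)" by simp
      also have "\<dots> \<le> (t * t) * (\<beta> * n ^ 2)"
      proof (intro mult_right_mono)
        show "real (card M) \<le> t * t"
          using card_mono[OF _ M(1)] by (simp add: card_cartesian_product flip: of_nat_mult)
      qed (use \<beta> in auto)
      also have "\<dots> = \<eta> / 2 * n ^ 2" using t by (simp add: \<beta>_def power2_eq_square)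
      finally show ?thesis .
    qed
    ultimately show False using cD by linarith
  qed

  \<comment> \<open>Counting good samples by the odd cycle they contain\<close>
  define Y where "Y q = {y \<in> {..<q} \<rightarrow>\<^sub>E ?V. \<forall>j<q. \<beta> * n ^ 2 \<le> card (three_walks G (y j) (y (Suc j mod q)))}" for q
  have finY: "finite (Y q)" for q
    by (rule finite_subset[of _ "{..<q} \<rightarrow>\<^sub>E ?V"]) (auto simp: Y_def fin intro: finite_PiE)
  define Q where "Q = {q. odd q \<and> q \<le> t}"
  \<comment> \<open>\<open>J q\<close> lists the possible locations of a cycle of length
    \<open>q\<close> among the \<open>t\<close> sample positions. Fixing the location leaves the
    other \<open>t - q\<close> sample vertices free.\<close>
  define J where "J q = {\<iota> \<in> {..<q} \<rightarrow>\<^sub>E {..<t}. inj_on \<iota> {..<q}}" for q :: nat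
  have finQ: "finite Q" by (rule finite_subset[of _ "{..t}"]) (auto simp: Q_def)
  have J: "J q \<subseteq> {..<q} \<rightarrow>\<^sub>E {..<t}" for q by (auto simp: J_def)
  have finPt: "finite ({..<q} \<rightarrow>\<^sub>E {..<t})" for q :: nat by (intro finite_PiE) auto
  have finJ: "finite (J q)" for q using finite_subset[OF J finPt] .
  have cJ: "card (J q) \<le> t ^ q" for q using card_mono[OF finPt J, of q] by (simp add: card_PiE)
  define X where "X q \<iota> = {s \<in> S. (\<lambda>j\<in>{..<q}. s (\<iota> j)) \<in> Y q}" for q \<iota>
  have "A \<subseteq> (\<Union>q\<in>Q. \<Union>\<iota>\<in>J q. X q \<iota>)"
  proof
    fix s assume s: "s \<in> A"
    from odd_cycle_if_not_two_colourable[OF symR colR[OF s]] obtain q f where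
      qf: "odd q" "inj_on f {..<q}" "\<And>i. i < q \<Longrightarrow> (f i, f (Suc i mod q)) \<in> R s" by blast
    have ft: "f ` {..<q} \<subseteq> {..<t}" using qf(3) by (auto simp: R_def)
    then have "q \<le> t" using card_inj_on_le[OF qf(2), of "{..<t}"] by simp
    then have "q \<in> Q" using qf(1) by (simp add: Q_def)
    moreover have "restrict f {..<q} \<in> J q" using qf(2) ft by (auto simp: J_def inj_on_def)
    moreover have "s \<in> X q (restrict f {..<q})"
    proof -
      have sS: "s \<in> S" using s A by auto
      have "s (f j) \<in> ?V" if "j < q" for j using sS ft that by (auto simp: S_def)
      moreover have "\<beta> * n ^ 2 \<le> card (three_walks G (s (f j)) (s (f (Suc j mod q))))" if "j < q" for j
        using qf(3)[OF that] by (simp add: R_def)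
      moreover have "Suc j mod q < q" if "j < q" for j using that by simp
      ultimately show ?thesis using sS by (auto simp: X_def Y_def)
    qed
    ultimately show "s \<in> (\<Union>q\<in>Q. \<Union>\<iota>\<in>J q. X q \<iota>)" by blast
  qed
  moreover have "finite (X q \<iota>)" for q \<iota> using finS by (simp add: X_def)
  ultimately have "card A \<le> card (\<Union>q\<in>Q. \<Union>\<iota>\<in>J q. X q \<iota>)"
    using finQ finJ by (intro card_mono) auto
  also have "\<dots> \<le> (\<Sum>q\<in>Q. card (\<Union>\<iota>\<in>J q. X q \<iota>))" by (rule card_UN_le[OF finQ])
  also have "\<dots> \<le> (\<Sum>q\<in>Q. \<Sum>\<iota>\<in>J q. card (X q \<iota>))" by (intro sum_mono card_UN_le finJ)
  also have "\<dots> \<le> (\<Sum>q\<in>Q. \<Sum>\<iota>\<in>J q. card (Y q) * n ^ (t - q))"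
  proof (intro sum_mono)
    fix q \<iota> assume q: "q \<in> Q" and \<iota>: "\<iota> \<in> J q"
    have "card (X q \<iota>) \<le> card (Y q) * card ?V ^ (card {..<t} - card {..<q})"
    proof (rule card_PiE_pullback_le[where \<iota> = \<iota>])
      show "inj_on \<iota> {..<q}" "\<iota> ` {..<q} \<subseteq> {..<t}" using \<iota> by (auto simp: J_def)
    qed (use fin finY in \<open>auto simp: X_def S_def\<close>)
    then show "card (X q \<iota>) \<le> card (Y q) * n ^ (t - q)" by (simp add: n_def)
  qed
  also have "\<dots> \<le> (\<Sum>q\<in>Q. t ^ q * (card (Y q) * n ^ (t - q)))"
    using cJ by (intro sum_mono) (auto intro: mult_right_mono)
  finally have "real (card A) \<le> (\<Sum>q\<in>Q. real t ^ q * (card (Y q) * real n ^ (t - q)))"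
    by (simp flip: of_nat_power of_nat_mult of_nat_sum)
  also have "\<dots> \<le> (\<Sum>q\<in>Q. real t ^ q * (card (closed_walks G (3 * q)) / (\<beta> * n ^ 2) ^ q * real n ^ (t - q)))"
  proof (intro sum_mono mult_left_mono mult_right_mono)
    fix q
    have "card (Y q) * (\<beta> * n ^ 2) ^ q \<le> card (closed_walks G (3 * q))"
      unfolding Y_def using \<beta> by (intro card_closed_walks_triple_ge G) auto
    moreover have "(\<beta> * n ^ 2) ^ q > 0" using \<beta> n by simp
    ultimately show "card (Y q) \<le> card (closed_walks G (3 * q)) / (\<beta> * n ^ 2) ^ q"
      by (simp add: pos_le_divide_eq)
  qed auto
  finally show ?thesis using cA unfolding Q_def by simp
qed

text \<open>The sample size \<open>t\<close> depends only on \<open>c\<close> and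
  \<open>\<eta>\<close>. For a graph far from bipartite the preceding lemma bounds
  \<open>n ^ t / 2\<close> by a sum over boundedly many \<open>q\<close>, whose terms are all
  \<open>o(n ^ t)\<close> when closed walks of length \<open>3 * q\<close> are few.\<close>

lemma few_closed_walks_imp_near_bipartite:
  fixes c \<eta> :: real
  assumes \<G>: "\<And>n G. \<G> n G \<Longrightarrow> simple_graph G \<and> card (verts G) = n"
    and deg: "\<And>n G v. \<G> n G \<Longrightarrow> v \<in> verts G \<Longrightarrow> c * real n \<le> real (degree G v)"
    and c: "0 < c" "c < 1" and "\<eta> > 0"
    and few: "\<And>l. odd l \<Longrightarrow> 3 \<le> l \<Longrightarrow> few_closed_walks \<G> l"
  shows "\<forall>\<^sub>F n in sequentially. \<forall>G. \<G> n G \<longrightarrow>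
     (\<exists>D\<subseteq>edges G. real (card D) \<le> \<eta> * (real n)\<^sup>2 \<and> partite 2 (verts G, edges G - D))"
proof -
  have "\<exists>k. (1 - c) ^ k < \<eta> / 4" using c \<open>\<eta> > 0\<close> by (intro real_arch_pow_inv) auto
  then obtain k where k: "(1 - c) ^ k < \<eta> / 4" by blast
  define t where "t = Suc k"
  have t: "t > 0" by (simp add: t_def)
  have "(1 - c) * (1 - c) ^ k \<le> 1 * (1 - c) ^ k" using c by (intro mult_right_mono) auto
  then have tc: "(1 - c) ^ t \<le> \<eta> / 4" using k by (simp add: t_def)
  define \<beta> where "\<beta> = \<eta> / (2 * t ^ 2)"
  have \<beta>: "\<beta> > 0" using t \<open>\<eta> > 0\<close> by (simp add: \<beta>_def)
  define Q where "Q = {q. odd q \<and> q \<le> t}"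
  have finQ: "finite Q" by (rule finite_subset[of _ "{..t}"]) (auto simp: Q_def)
  \<comment> \<open>With fewer than \<open>\<epsilon> * n ^ (3 * q)\<close> closed walks the term
    for \<open>q\<close> is at most \<open>(t / \<beta>) ^ q * \<epsilon> * n ^ t\<close>. So the
    sum is at most \<open>K * \<epsilon> * n ^ t\<close>, and \<open>\<epsilon>\<close> is chosen to
    keep \<open>K * \<epsilon>\<close> below one half.\<close>
  define K where "K = (\<Sum>q\<in>Q. (t / \<beta>) ^ q)"
  have K: "K \<ge> 0" unfolding K_def using \<beta> by (intro sum_nonneg) auto
  define \<epsilon> where "\<epsilon> = 1 / (4 * (K + 1))"
  have \<epsilon>: "\<epsilon> > 0" using K by (simp add: \<epsilon>_def)
  have "\<forall>q\<in>Q. \<forall>\<^sub>F n in sequentially. \<forall>G. \<G> n G \<longrightarrow>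
      real (card (closed_walks G (3 * q))) < \<epsilon> * real n ^ (3 * q)"
  proof
    fix q assume "q \<in> Q"
    then have "few_closed_walks \<G> (3 * q)" by (intro few) (auto simp: Q_def elim: oddE)
    then show "\<forall>\<^sub>F n in sequentially. \<forall>G. \<G> n G \<longrightarrow>
      real (card (closed_walks G (3 * q))) < \<epsilon> * real n ^ (3 * q)"
      using \<epsilon> unfolding few_closed_walks_def by blast
  qed
  then have "\<forall>\<^sub>F n in sequentially. \<forall>q\<in>Q. \<forall>G. \<G> n G \<longrightarrow>
      real (card (closed_walks G (3 * q))) < \<epsilon> * real n ^ (3 * q)"
    by (rule eventually_ball_finite[OF finQ])
  moreover have "\<forall>\<^sub>F n in sequentially. n \<ge> (1 :: nat)" by (rule eventually_ge_at_top)
  ultimately show ?thesis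
  proof eventually_elim
    case (elim n)
    show ?case
    proof (intro allI impI, rule ccontr)
      fix G assume G: "\<G> n G"
        and no: "\<not> (\<exists>D\<subseteq>edges G. real (card D) \<le> \<eta> * (real n)\<^sup>2 \<and> partite 2 (verts G, edges G - D))"
      have sG: "simple_graph G" "card (verts G) = n" using \<G>[OF G] by auto
      have n: "real n > 0" using elim(2) by simp
      have "real n ^ t / 2 \<le> (\<Sum>q\<in>Q.
          t ^ q * (card (closed_walks G (3 * q)) / (\<beta> * n ^ 2) ^ q * real n ^ (t - q)))"
        using far_from_bipartite_imp_closed_walks[OF sG(1), of t \<eta> c] sG(2) elim(2) t tc \<open>\<eta> > 0\<close> deg[OF G] no
        unfolding Q_def \<beta>_def by auto
      also have "\<dots> \<le> (\<Sum>q\<in>Q. (t / \<beta>) ^ q * (\<epsilon> * real n ^ t))"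
      proof (rule sum_mono)
        fix q assume q: "q \<in> Q"
        have "real (card (closed_walks G (3 * q))) \<le> \<epsilon> * real n ^ (3 * q)"
          using elim(1) q G by (blast intro: less_imp_le)
        then have "t ^ q * (card (closed_walks G (3 * q)) / (\<beta> * n ^ 2) ^ q * real n ^ (t - q))
          \<le> t ^ q * (\<epsilon> * real n ^ (3 * q) / (\<beta> * n ^ 2) ^ q * real n ^ (t - q))"
          using \<beta> by (intro mult_left_mono mult_right_mono divide_right_mono) auto
        also have "\<dots> = (t / \<beta>) ^ q * (\<epsilon> * (real n ^ q * real n ^ (t - q)))"
        proof -
          have "real n ^ (3 * q) = real n ^ q * (real n ^ 2) ^ q"
            by (simp flip: power_mult power_add)
          then show ?thesis using n \<beta> by (simp add: power_mult_distrib power_divide)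
        qed
        also have "real n ^ q * real n ^ (t - q) = real n ^ t"
          using q by (simp add: Q_def flip: power_add)
        finally show "t ^ q * (card (closed_walks G (3 * q)) / (\<beta> * n ^ 2) ^ q * real n ^ (t - q))
          \<le> (t / \<beta>) ^ q * (\<epsilon> * real n ^ t)" .
      qed
      also have "\<dots> = (K * \<epsilon>) * real n ^ t" by (simp add: K_def sum_distrib_right mult.assoc)
      finally have "1 / 2 * real n ^ t \<le> (K * \<epsilon>) * real n ^ t" by simp
      then have "1 / 2 \<le> K * \<epsilon>" using n by (simp only: mult_le_cancel_right_pos zero_less_power)
      then show False using K by (simp add: \<epsilon>_def field_simps)
    qed
  qed
qed

section \<open>Blow-ups of odd cycles\<close>

lemma odd_cycle_not_two_colourable:
  fixes f :: "nat \<Rightarrow> bool"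
  assumes "odd l"
  shows "\<exists>i<l. f i = f (Suc i mod l)"
proof (rule ccontr)
  assume "\<not> ?thesis"
  then have alt: "f (Suc i mod l) \<noteq> f i" if "i < l" for i using that by metis
  have "f i = (f 0 = even i)" if "i < l" for i
    using that
  proof (induction i)
    case (Suc i)
    then have "f (Suc i) \<noteq> f i" using alt[of i] by simp
    then show ?case using Suc by auto
  qed simp
  from this[of "l - 1"] have "f (l - 1) = f 0" using assms by (auto simp: odd_pos)
  moreover have "Suc (l - 1) mod l = 0" "l - 1 < l" using assms odd_pos by auto
  ultimately show False using alt[of "l - 1"] by simp
qed

text \<open>The parts are the residue classes modulo \<open>l\<close>: the vertex
  \<open>i + l * k\<close> has index \<open>k\<close> in part \<open>i\<close>, and reduction modulo
  \<open>l\<close> projects onto the cycle.\<close>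

definition cycle_blowup :: "nat \<Rightarrow> nat \<Rightarrow> nat graph" where
  "cycle_blowup l m = ({..<l * m}, {{u, v} | u v. u < l * m \<and> v < l * m \<and> v mod l = Suc u mod l})"

lemma mod_Suc_ne_self: "3 \<le> l \<Longrightarrow> Suc u mod l \<noteq> u mod l" for u l :: nat
  by (simp add: mod_Suc)

lemma simple_cycle_blowup: "3 \<le> l \<Longrightarrow> simple_graph (cycle_blowup l m)"
  using mod_Suc_ne_self[of l] by (auto simp: simple_graph_def cycle_blowup_def card_2_iff) metis

lemma cycle_blowup_hom:
  assumes "3 \<le> l" "{u, v} \<in> edges (cycle_blowup l m)"
  shows "{u mod l, v mod l} \<in> edges (cycle_graph l)"
proof -
  obtain a b where ab: "{u, v} = {a, b}" "b mod l = Suc a mod l"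
    using assms(2) by (auto simp: cycle_blowup_def)
  have "{u mod l, v mod l} = (\<lambda>w. w mod l) ` {u, v}" by simp
  also have "\<dots> = {a mod l, Suc (a mod l) mod l}" unfolding ab(1) using ab(2) by (simp add: mod_Suc_eq)
  finally show ?thesis using assms(1) by (auto simp: cycle_graph_def)
qed

text \<open>A copy of \<open>H\<close> followed by the projection modulo \<open>l\<close> would be a
  homomorphism to the cycle.\<close>

lemma free_of_cycle_blowup:
  assumes H: "simple_graph H" "\<not> homomorphic H (cycle_graph l)" and l: "3 \<le> l"
  shows "free_of H (cycle_blowup l m)"
  unfolding free_of_def
proof
  assume "\<exists>G'. subgraph G' (cycle_blowup l m) \<and> isomorphic H G'"
  then obtain G' \<phi> where G': "subgraph G' (cycle_blowup l m)"
    and \<phi>: "\<And>u v. u \<in> verts H \<Longrightarrow> v \<in> verts H \<Longrightarrow> {u, v} \<in> edges H \<Longrightarrow> {\<phi> u, \<phi> v} \<in> edges G'"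
    unfolding isomorphic_def by blast
  have "homomorphic H (cycle_graph l)"
    unfolding homomorphic_def
  proof (intro exI conjI allI impI)
    show "(\<lambda>u. \<phi> u mod l) ` verts H \<subseteq> verts (cycle_graph l)"
      using l by (auto simp: cycle_graph_def)
    fix u v assume uv: "{u, v} \<in> edges H"
    then have "{\<phi> u, \<phi> v} \<in> edges (cycle_blowup l m)"
      using \<phi>[of u v] G' edge_imp_verts[OF H(1) uv] by (auto simp: subgraph_def)
    then show "{\<phi> u mod l, \<phi> v mod l} \<in> edges (cycle_graph l)" by (rule cycle_blowup_hom[OF l])
  qed
  then show False using H(2) by blast
qed

lemma blowup_vertex: "i < l \<Longrightarrow> k < m \<Longrightarrow> i + l * k < l * m" for i k l m :: nat
proof -
  assume "i < l" "k < m"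
  then have "i + l * k < l * Suc k" by simp
  also have "\<dots> \<le> l * m" using \<open>k < m\<close> by (intro mult_le_mono2) auto
  finally show ?thesis .
qed

lemma degree_cycle_blowup_ge:
  assumes l: "3 \<le> l" and v: "v < l * m"
  shows "2 * m \<le> degree (cycle_blowup l m) v"
proof -
  let ?N = "{w \<in> verts (cycle_blowup l m). {v, w} \<in> edges (cycle_blowup l m)}"
  \<comment> \<open>The neighbours of \<open>v\<close> fill the next and the previous part; adding
    \<open>l - 1\<close> steps back without truncated subtraction. The two parts differ as
    \<open>l \<ge> 3\<close>.\<close>
  define F where "F = (\<lambda>(b, k). (if b then Suc v mod l else (v + (l - 1)) mod l) + l * k)"
  have pred: "Suc ((v + (l - 1)) mod l) mod l = v mod l"
    using l by (simp add: mod_Suc_eq)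
  have ne: "Suc v mod l \<noteq> (v + (l - 1)) mod l"
  proof
    assume "Suc v mod l = (v + (l - 1)) mod l"
    then have "Suc (Suc v mod l) mod l = v mod l" using pred by metis
    then have "Suc (Suc (v mod l)) mod l = v mod l" by (simp add: mod_Suc_eq mod_Suc_Suc_eq)
    then show False using l by (auto simp: mod_Suc split: if_splits)
  qed
  have Fm: "F (b, k) mod l = (if b then Suc v mod l else (v + (l - 1)) mod l)"
      "F (b, k) div l = k" for b k
    using l by (auto simp: F_def)
  have "inj_on F (UNIV \<times> {..<m})"
  proof (rule inj_onI, clarify)
    fix b k b' k' assume "F (b, k) = F (b', k')"
    then have "F (b, k) mod l = F (b', k') mod l" "F (b, k) div l = F (b', k') div l" by simp_all
    then show "b = b' \<and> k = k'" unfolding Fm using ne by (auto split: if_splits)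
  qed
  moreover have "F ` (UNIV \<times> {..<m}) \<subseteq> ?N"
  proof
    fix w assume "w \<in> F ` (UNIV \<times> {..<m})"
    then obtain b k where w: "w = F (b, k)" "k < m" by auto
    then have lt: "F (b, k) < l * m" unfolding F_def using l by (auto intro!: blowup_vertex)
    have "{v, F (b, k)} \<in> edges (cycle_blowup l m)"
    proof (cases b)
      case True
      then have "F (b, k) mod l = Suc v mod l" using Fm by simp
      then show ?thesis using v lt by (auto simp: cycle_blowup_def)
    next
      case False
      then have "v mod l = Suc (F (b, k)) mod l"
        using Fm(1)[of b k] pred by (metis mod_Suc_eq)
      then have "{F (b, k), v} \<in> edges (cycle_blowup l m)" using v lt by (auto simp: cycle_blowup_def)
      then show ?thesis by (simp add: insert_commute)
    qed
    then show "w \<in> ?N" using lt by (simp add: w(1) cycle_blowup_def)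
  qed
  moreover have "finite ?N" by (simp add: cycle_blowup_def)
  ultimately have "card ((UNIV :: bool set) \<times> {..<m}) \<le> card ?N" by (rule card_inj_on_le)
  then show ?thesis
    using degree_eq_card_neighbours[OF simple_cycle_blowup[OF l]] by (simp add: card_cartesian_product)
qed

lemma cycle_edge_inj:
  fixes i j l :: nat
  assumes "3 \<le> l" "i < l" "j < l" "{i, Suc i mod l} = {j, Suc j mod l}"
  shows "i = j"
  using assms by (auto simp: doubleton_eq_iff mod_Suc split: if_splits)

text \<open>The \<open>m\<^sup>2\<close> cycles whose indices alternate \<open>a, b, a, b, \<dots>\<close> and close up with
  \<open>a + b\<close> modulo \<open>m\<close> are pairwise edge-disjoint: any two consecutive indices determine \<open>a\<close> and \<open>b\<close>.\<close>

lemma cycle_blowup_far_from_bipartite: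
  assumes l: "odd l" "3 \<le> l" and D: "D \<subseteq> edges (cycle_blowup l m)"
    and part: "partite 2 (verts (cycle_blowup l m), edges (cycle_blowup l m) - D)"
  shows "m\<^sup>2 \<le> card D"
proof -
  let ?B = "cycle_blowup l m"
  have finD: "finite D"
  proof (rule finite_subset)
    show "D \<subseteq> Pow {..<l * m}" using D by (auto simp: cycle_blowup_def)
  qed simp
  obtain f :: "nat \<Rightarrow> nat" where f: "f ` verts ?B \<subseteq> {..<2}"
    "\<And>u v. {u, v} \<in> edges ?B - D \<Longrightarrow> f u \<noteq> f v"
    using part unfolding partite_def by auto
  \<comment> \<open>The index within part \<open>i\<close> of the cycle given by
    \<open>(a, b)\<close>. As \<open>l\<close> is odd, plain alternation would use \<open>a\<close>
    in both part \<open>0\<close> and part \<open>l - 1\<close>; the changed last index lets the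
    closing edge determine \<open>b\<close> too.\<close>
  define ix where "ix a b i = (if i = l - 1 then (a + b) mod m else if even i then a else b)" for a b i
  define x where "x a b i = i + l * ix a b i" for a b i
  have ix: "ix a b i < m" if "a < m" "b < m" for a b i using that by (auto simp: ix_def)
  have xm: "x a b i mod l = i" "x a b i div l = ix a b i" if "i < l" for a b i
    using that by (auto simp: x_def)
  have xV: "x a b i < l * m" if "i < l" "a < m" "b < m" for a b i
    unfolding x_def using that ix by (intro blowup_vertex) auto
  have ex: "\<exists>i<l. {x a b i, x a b (Suc i mod l)} \<in> D" if ab: "a < m" "b < m" for a b
  proof -
    obtain i where "i < l \<and> (f (x a b i) = 0) = (f (x a b (Suc i mod l)) = 0)"
      using odd_cycle_not_two_colourable[OF l(1), of "\<lambda>i. f (x a b i) = 0"] by (rule exE)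
    then have i: "i < l" "(f (x a b i) = 0) = (f (x a b (Suc i mod l)) = 0)" by simp_all
    have i': "Suc i mod l < l" using l by simp
    have V: "x a b i < l * m" "x a b (Suc i mod l) < l * m" using xV ab i(1) i' by auto
    then have "f (x a b i) < 2" "f (x a b (Suc i mod l)) < 2" using f(1) by (auto simp: cycle_blowup_def)
    then have "f (x a b i) = f (x a b (Suc i mod l))" using i(2) by auto
    then have "{x a b i, x a b (Suc i mod l)} \<notin> edges ?B - D" using f(2) by blast
    moreover have "x a b (Suc i mod l) mod l = Suc (x a b i) mod l"
      using xm(1)[OF i(1)] xm(1)[OF i'] by (metis mod_Suc_eq)
    then have "{x a b i, x a b (Suc i mod l)} \<in> edges ?B" using V by (auto simp: cycle_blowup_def)
    ultimately show ?thesis using i(1) by blast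
  qed
  define p where "p a b = (SOME i. i < l \<and> {x a b i, x a b (Suc i mod l)} \<in> D)" for a b
  have p: "p a b < l" "{x a b (p a b), x a b (Suc (p a b) mod l)} \<in> D" if "a < m" "b < m" for a b
    using someI_ex[OF ex[OF that, unfolded Bex_def]] by (auto simp: p_def)
  \<comment> \<open>Each of these cycles is odd, so it has a monochromatic edge, which must lie in
    \<open>D\<close>; \<open>F\<close> picks one.\<close>
  define F where "F = (\<lambda>(a, b). {x a b (p a b), x a b (Suc (p a b) mod l)})"
  have "inj_on F ({..<m} \<times> {..<m})"
  proof (rule inj_onI)
    fix u v assume uv: "u \<in> {..<m} \<times> {..<m}" "v \<in> {..<m} \<times> {..<m}" "F u = F v"
    obtain a b a' b' where uv_eq: "u = (a, b)" "v = (a', b')" by fastforce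
    then have ab: "a < m" "b < m" "a' < m" "b' < m" and eq: "F (a, b) = F (a', b')" using uv by auto
    define i where "i = p a b"
    define j where "j = p a' b'"
    have ij: "i < l" "j < l" using p(1) ab by (auto simp: i_def j_def)
    define i' where "i' = Suc i mod l"
    have i': "i' < l" "i' \<noteq> i" using l ij mod_Suc_ne_self[of l i] by (auto simp: i'_def)
    have eq': "{x a b i, x a b i'} = {x a' b' j, x a' b' (Suc j mod l)}"
      using eq by (simp add: F_def i_def j_def i'_def)
    have "(\<lambda>w. w mod l) ` {x a b i, x a b i'} = {i, i'}" using xm(1) ij i' by simp
    moreover have "(\<lambda>w. w mod l) ` {x a' b' j, x a' b' (Suc j mod l)} = {j, Suc j mod l}"
      using xm(1) ij l by simp
    ultimately have "{i, i'} = {j, Suc j mod l}" using eq' by metis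
    then have "i = j" using cycle_edge_inj[OF l(2) ij] by (simp add: i'_def)
    then have eq2: "{x a b i, x a b i'} = {x a' b' i, x a' b' i'}" using eq' by (simp add: i'_def)
    then have "x a b i = x a' b' i \<and> x a b i' = x a' b' i'"
      using xm(1)[OF ij(1)] xm(1)[OF i'(1)] i'(2) by (metis doubleton_eq_iff)
    then have ixeq: "ix a b i = ix a' b' i" "ix a b i' = ix a' b' i'"
      using xm(2)[OF ij(1)] xm(2)[OF i'(1)] by metis+
    have canc: "u = v" if "(w + u) mod m = (w + v) mod m" "u < m" "v < m" "w < m" for u v w :: nat
    proof -
      have "(w + k) mod m = (if w + k < m then w + k else w + k - m)" if "k < m" for k
        using \<open>w < m\<close> that by (simp add: le_mod_geq)
      then show ?thesis using that by (auto split: if_splits)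
    qed
    \<comment> \<open>The two indices seen on the edge are \<open>a\<close> and \<open>b\<close> in
      the interior, \<open>b\<close> and \<open>a + b\<close> just before the last part, and
      \<open>a + b\<close> and \<open>a\<close> on the closing edge.\<close>
    consider "Suc i < l - 1" | "Suc i = l - 1" | "i = l - 1" using ij(1) by linarith
    then have "a = a' \<and> b = b'"
    proof cases
      case 1
      then have "i' = Suc i" "i \<noteq> l - 1" "Suc i \<noteq> l - 1" by (auto simp: i'_def)
      then show ?thesis using ixeq by (cases "even i") (auto simp: ix_def)
    next
      case 2
      then have "i' = l - 1" "i \<noteq> l - 1" using l by (auto simp: i'_def)
      moreover have "odd i" using 2 l by presburger
      ultimately have "b = b'" "(a + b) mod m = (a' + b') mod m" using ixeq by (auto simp: ix_def)
      then show ?thesis using canc[of b a a'] ab by (simp add: add.commute)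
    next
      case 3
      then have "i' = 0" "0 \<noteq> l - 1" using l by (auto simp: i'_def)
      then have "a = a'" "(a + b) mod m = (a' + b') mod m" using ixeq 3 by (auto simp: ix_def)
      then show ?thesis using canc[of a b b'] ab by simp
    qed
    then show "u = v" by (simp add: uv_eq)
  qed
  moreover have "F ` ({..<m} \<times> {..<m}) \<subseteq> D" using p(2) by (auto simp: F_def)
  ultimately have "card ({..<m} \<times> {..<m}) \<le> card D" using finD by (rule card_inj_on_le)
  then show ?thesis by (simp add: card_cartesian_product power2_eq_square)
qed

section \<open>The threshold\<close>

text \<open>Lift the walk to the integers: every step changes the position by 1 or -1 modulo
  \<open>k\<close>. The total displacement is odd, hence nonzero, is at most \<open>l\<close> in
  absolute value, and is divisible by \<open>k\<close> since the walk closes.\<close>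

lemma closed_odd_walk_in_cycle:
  fixes f :: "nat \<Rightarrow> nat"
  assumes l: "odd l" and f: "f l = f 0"
    "\<And>i. i < l \<Longrightarrow> \<exists>j<k. {f i, f (Suc i)} = {j, Suc j mod k}"
  shows "k \<le> l"
proof (rule ccontr)
  assume "\<not> k \<le> l"
  then have kl: "l < k" by simp
  have "\<exists>z::int. \<bar>z\<bar> \<le> i \<and> (even z \<longleftrightarrow> even i) \<and> int k dvd int (f i) - int (f 0) - z" if "i \<le> l" for i
    using that
  proof (induction i)
    case (Suc i)
    then obtain z :: int where z: "\<bar>z\<bar> \<le> i" "even z \<longleftrightarrow> even i"
      "int k dvd int (f i) - int (f 0) - z" by auto
    obtain j where j: "j < k" "{f i, f (Suc i)} = {j, Suc j mod k}" using f(2)[of i] Suc.prems by auto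
    have kd: "int k dvd int (Suc j mod k) - int (Suc j)"
      by (metis dvd_minus_mod dvd_diff_commute of_nat_dvd_iff of_nat_mod zmod_int)
    consider "f i = j" "f (Suc i) = Suc j mod k" | "f (Suc i) = j" "f i = Suc j mod k"
      using j(2) by (auto simp: doubleton_eq_iff)
    then show ?case
    proof cases
      case 1
      have "int k dvd (int (f i) - int (f 0) - z) + (int (Suc j mod k) - int (Suc j))"
        using z(3) kd by (rule dvd_add)
      also have "\<dots> = int (f (Suc i)) - int (f 0) - (z + 1)" using 1 by simp
      finally show ?thesis using z(1,2) by (intro exI[of _ "z + 1"]) auto
    next
      case 2
      have "int k dvd (int (f i) - int (f 0) - z) - (int (Suc j mod k) - int (Suc j))"
        using z(3) kd by (rule dvd_diff)
      also have "\<dots> = int (f (Suc i)) - int (f 0) - (z - 1)" using 2 by simp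
      finally show ?thesis using z(1,2) by (intro exI[of _ "z - 1"]) auto
    qed
  qed auto
  from this[of l] f(1) obtain z :: int where z: "\<bar>z\<bar> \<le> l" "odd z" "int k dvd z"
    using l by auto
  then have "z \<noteq> 0" by auto
  then have "int k \<le> \<bar>z\<bar>" using z(3) by (intro zdvd_imp_le) auto
  then show False using z(1) kl by linarith
qed

lemma not_bipartite_imp_monochromatic_edge:
  assumes "\<not> partite 2 H"
  shows "\<exists>(u, v) \<in> {(u, v). {u, v} \<in> edges H}. \<chi> u = (\<chi> v :: bool)"
proof (rule ccontr)
  assume "\<not> ?thesis"
  then have "partite 2 H" unfolding partite_def
    by (intro exI[of _ "\<lambda>u. if \<chi> u then 1 else 0"]) auto
  then show False using assms by blast
qed

text \<open>\<open>H\<close> has an odd closed walk of some length \<open>l\<close>; its image in a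
  cycle of length \<open>2 * l + 1\<close> would be an odd closed walk shorter than that
  cycle.\<close>

lemma not_bipartite_imp_not_hom_long_cycle:
  assumes "\<not> partite 2 H"
  shows "\<exists>g>0. \<not> homomorphic H (cycle_graph (2 * g + 1))"
proof -
  let ?R = "{(u, v). {u, v} \<in> edges H}"
  have "sym ?R" by (auto simp: sym_def insert_commute)
  from odd_cycle_if_not_two_colourable[OF this not_bipartite_imp_monochromatic_edge[OF assms]]
  obtain l f where lf: "odd l" "\<And>i. i < l \<Longrightarrow> {f i, f (Suc i mod l)} \<in> edges H" by blast
  have "\<not> homomorphic H (cycle_graph (2 * l + 1))"
  proof
    assume "homomorphic H (cycle_graph (2 * l + 1))"
    then obtain \<phi> where \<phi>: "\<And>u v. {u, v} \<in> edges H \<Longrightarrow> {\<phi> u, \<phi> v} \<in> edges (cycle_graph (2 * l + 1))"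
      unfolding homomorphic_def by blast
    have "2 * l + 1 \<le> l"
    proof (rule closed_odd_walk_in_cycle[OF lf(1), of "\<lambda>i. \<phi> (f (i mod l))"])
      fix i assume "i < l"
      then show "\<exists>j<2 * l + 1. {\<phi> (f (i mod l)), \<phi> (f (Suc i mod l))} = {j, Suc j mod (2 * l + 1)}"
        using \<phi>[OF lf(2)[of i]] by (auto simp: cycle_graph_def)
    qed auto
    then show False by simp
  qed
  moreover have "l > 0" using lf(1) by (rule odd_pos)
  ultimately show ?thesis by blast
qed

lemma partite_three_imp_hom_triangle:
  assumes H: "simple_graph H" "partite 3 H"
  shows "homomorphic H (cycle_graph 3)"
proof -
  obtain f :: "'a \<Rightarrow> nat" where f: "f ` verts H \<subseteq> {..<3}" "\<And>u v. {u, v} \<in> edges H \<Longrightarrow> f u \<noteq> f v"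
    using H(2) unfolding partite_def by blast
  have tri: "{a, b} \<in> edges (cycle_graph 3)" if "a < 3" "b < 3" "a \<noteq> b" for a b
  proof -
    have "a = 0 \<or> a = 1 \<or> a = 2" "b = 0 \<or> b = 1 \<or> b = 2" using that by linarith+
    then have "b = Suc a mod 3 \<or> a = Suc b mod 3" using that(3) by (elim disjE) simp_all
    then have "{a, b} = {a, Suc a mod 3} \<or> {a, b} = {b, Suc b mod 3}" by blast
    then show ?thesis unfolding cycle_graph_def using that(1,2) by auto
  qed
  have "{f u, f v} \<in> edges (cycle_graph 3)" if uv: "{u, v} \<in> edges H" for u v
    using f(1) edge_imp_verts[OF H(1) uv] f(2)[OF uv] by (intro tri) auto
  then show ?thesis unfolding homomorphic_def using f(1) by (auto simp: cycle_graph_def)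
qed

text \<open>Since the chromatic number is a \<open>LEAST\<close>, attaining it requires some
  colouring to exist; an injective numbering of the vertices is one.\<close>

lemma chromatic_number_three:
  assumes "simple_graph H" "chromatic_number H = 3"
  shows "partite 3 H" "\<not> partite 2 H"
proof -
  have fin: "finite (verts H)" using assms by (simp add: simple_graph_def)
  then obtain f where f: "inj_on f (verts H)" "f ` verts H = {..<card (verts H)}"
    using ex_bij_betw_finite_nat[OF fin] by (auto simp: bij_betw_def atLeast0LessThan)
  have "partite (card (verts H)) H"
    unfolding partite_def
  proof (intro exI[of _ f] conjI allI impI)
    fix u v assume "{u, v} \<in> edges H"
    from edge_imp_verts[OF assms(1) this] show "f u \<noteq> f v" using f(1) by (auto simp: inj_on_def)
  qed (use f in auto)
  then have "partite (LEAST r. partite r H) H" by (rule LeastI)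
  then show "partite 3 H" using assms(2) by (simp add: chromatic_number_def)
  show "\<not> partite 2 H" using assms(2) not_less_Least[of 2 "\<lambda>r. partite r H"]
    by (simp add: chromatic_number_def)
qed

text \<open>The blow-up of the \<open>l\<close>-cycle with parts of size \<open>m\<close> has
  \<open>n = l * m\<close> vertices and minimum degree at least \<open>2 * n / l\<close>, so it
  refutes even \<open>c = 2 / l\<close>. Making it bipartite costs at least
  \<open>n ^ 2 / l ^ 2\<close> edges, twice what \<open>\<eta>\<close> permits.\<close>

lemma not_forces_near_partite:
  assumes H: "simple_graph H" "chromatic_number H = 3" "\<not> homomorphic H (cycle_graph l)"
    and l: "odd l" "3 \<le> l" and c: "c \<le> 2 / l"
  shows "\<not> forces_near_partite H c"
proof
  assume F: "forces_near_partite H c"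
  define \<eta> :: real where "\<eta> = 1 / (2 * l ^ 2)"
  have "\<eta> > 0" using l by (simp add: \<eta>_def)
  moreover have "chromatic_number H - 1 = 2" using H(2) by simp
  ultimately obtain n0 where n0: "\<forall>G :: nat graph.
        simple_graph G \<and> card (verts G) \<ge> n0 \<and> free_of H G \<and>
        real (min_degree G) \<ge> c * real (card (verts G)) \<longrightarrow>
        (\<exists>D\<subseteq>edges G. real (card D) \<le> \<eta> * (real (card (verts G)))\<^sup>2 \<and>
           partite 2 (verts G, edges G - D))"
    using F unfolding forces_near_partite_def by metis
  define m where "m = Suc n0"
  have "m > 0" by (simp add: m_def)
  let ?B = "cycle_blowup l m"
  have cV: "card (verts ?B) = l * m" "verts ?B = {..<l * m}" by (auto simp: cycle_blowup_def)
  have "min_degree ?B \<in> degree ?B ` verts ?B"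
    unfolding min_degree_def using l \<open>m > 0\<close> by (intro Min_in) (auto simp: cV lessThan_empty_iff)
  then have "2 * m \<le> min_degree ?B" using degree_cycle_blowup_ge[OF l(2)] by (auto simp: cV)
  moreover have "c * real (l * m) \<le> 2 / l * real (l * m)" using c by (intro mult_right_mono) auto
  then have "c * real (l * m) \<le> real (2 * m)" using l by simp
  ultimately have "c * real (card (verts ?B)) \<le> real (min_degree ?B)" unfolding cV(1) by linarith
  moreover have "n0 \<le> card (verts ?B)"
  proof -
    have "1 * m \<le> l * m" using l by (intro mult_le_mono1) auto
    then show ?thesis unfolding cV(1) by (simp add: m_def)
  qed
  ultimately obtain D where D: "D \<subseteq> edges ?B" "real (card D) \<le> \<eta> * (real (card (verts ?B)))\<^sup>2"
    "partite 2 (verts ?B, edges ?B - D)"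
    using n0 simple_cycle_blowup[OF l(2)] free_of_cycle_blowup[OF H(1,3) l(2)] by blast
  have "real (m\<^sup>2) \<le> real (card D)" using cycle_blowup_far_from_bipartite[OF l D(1,3)] by simp
  also have "\<dots> \<le> real (m\<^sup>2) / 2" using D(2) l by (simp add: cV \<eta>_def power_mult_distrib)
  finally show False by (simp add: m_def)
qed

text \<open>All odd closed walks are few: for lengths below \<open>2 * g + 1\<close> because
  \<open>H\<close> maps to the cycle of that length, and from there on by induction, as
  \<open>l * c > 2\<close>. Such graphs are near bipartite.\<close>

lemma forces_near_partite_above:
  assumes H: "simple_graph H" "chromatic_number H = 3"
    and hom: "\<And>k. 0 < k \<Longrightarrow> k < g \<Longrightarrow> homomorphic H (cycle_graph (2 * k + 1))"
    and g: "2 \<le> g" and c: "2 / (2 * real g + 1) < c"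
  shows "forces_near_partite H c"
  unfolding forces_near_partite_def
proof (intro allI impI)
  fix \<eta> :: real assume "\<eta> > 0"
  define \<G> where "\<G> n G \<longleftrightarrow> simple_graph G \<and> card (verts G) = n \<and> free_of H G \<and>
    c * real n \<le> real (min_degree G)" for n and G :: "nat graph"
  have \<G>: "simple_graph G \<and> card (verts G) = n" if "\<G> n G" for n G using that by (simp add: \<G>_def)
  have deg: "c * real n \<le> real (degree G v)" if "\<G> n G" "v \<in> verts G" for n G v
  proof -
    have "min_degree G \<le> degree G v"
      unfolding min_degree_def using that by (intro Min_le) (auto simp: \<G>_def simple_graph_def)
    then show ?thesis using that by (simp add: \<G>_def)
  qed
  have cpos: "c > 0" using c by (smt (verit) divide_pos_pos of_nat_0_le_iff)
  have V: "verts H \<noteq> {}"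
  proof
    assume "verts H = {}"
    then have "partite 2 H" unfolding partite_def
      using edge_imp_verts[OF H(1)] by auto
    then show False using chromatic_number_three(2)[OF H] by blast
  qed
  have few: "few_closed_walks \<G> l" if "odd l" "3 \<le> l" for l
    using that
  proof (induction l rule: less_induct)
    case (less l)
    show ?case
    proof (cases "l < 2 * g + 1")
      case True
      obtain k where k: "l = 2 * k + 1" using less.prems(1) by (elim oddE)
      then have homl: "homomorphic H (cycle_graph l)" using hom[of k] True less.prems by simp
      show ?thesis unfolding few_closed_walks_def \<G>_def
      proof (intro allI impI)
        fix \<epsilon> :: real assume "\<epsilon> > 0"
        from free_imp_few_closed_walks[OF H(1) V homl less.prems(2) this]
        show "\<forall>\<^sub>F n in sequentially. \<forall>G :: nat graph. simple_graph G \<and> card (verts G) = n \<and> free_of H G \<and>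
            c * real n \<le> real (min_degree G) \<longrightarrow> real (card (closed_walks G l)) < \<epsilon> * real n ^ l"
          by (rule eventually_mono) blast
      qed
    next
      case False
      then have "2 * real g + 1 \<le> real l" by linarith
      then have "(2 * real g + 1) * c \<le> real l * c" using cpos by (intro mult_right_mono) auto
      moreover have "2 < (2 * real g + 1) * c" using c by (simp add: field_simps)
      ultimately have lc: "real l * c > 2" by linarith
      \<comment> \<open>Here \<open>g \<ge> 2\<close> enters: the induction reaches the degree count
        only at lengths with room for a shorter odd walk.\<close>
      have l5: "5 \<le> l" using False g by linarith
      have IH: "few_closed_walks \<G> j" if "odd j" "3 \<le> j" "j < l" for j
        using less.IH[of j] that by blast
      show ?thesis
        by (rule few_closed_walks_step[of \<G> c]) (use \<G> deg less.prems(1) l5 lc IH in blast)+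
    qed
  qed
  have "\<forall>\<^sub>F n in sequentially. \<forall>G. \<G> n G \<longrightarrow>
     (\<exists>D\<subseteq>edges G. real (card D) \<le> \<eta> * (real n)\<^sup>2 \<and> partite 2 (verts G, edges G - D))"
  proof (cases "c < 1")
    case True
    show ?thesis
      by (rule few_closed_walks_imp_near_bipartite[of \<G> c])
        (use \<G> deg cpos True \<open>\<eta> > 0\<close> few in blast)+
  next
    case False
    \<comment> \<open>For \<open>c \<ge> 1\<close> the claim is vacuous, since degrees in a simple
      graph are below \<open>n\<close>.\<close>
    have "\<not> \<G> n G" if n: "n \<ge> 1" for n G
    proof
      assume G: "\<G> n G"
      then have "verts G \<noteq> {}" using \<G>[OF G] n by auto
      then obtain v where v: "v \<in> verts G" by blast
      have sG: "simple_graph G" "finite (verts G)" using G by (auto simp: \<G>_def simple_graph_def)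
      have "{w \<in> verts G. {v, w} \<in> edges G} \<subset> verts G" using v edge_imp_verts(3)[OF sG(1)] by blast
      then have "degree G v < n"
        using psubset_card_mono[OF sG(2)] \<G>[OF G] by (simp add: degree_eq_card_neighbours[OF sG(1)])
      moreover have "1 * real n \<le> c * real n" using False by (intro mult_right_mono) auto
      ultimately show False using deg[OF G v] by linarith
    qed
    then show ?thesis by (intro eventually_mono[OF eventually_ge_at_top[of 1]]) blast
  qed
  then obtain n0 where n0: "\<And>n G. n \<ge> n0 \<Longrightarrow> \<G> n G \<Longrightarrow>
     (\<exists>D\<subseteq>edges G. real (card D) \<le> \<eta> * (real n)\<^sup>2 \<and> partite 2 (verts G, edges G - D))"
    unfolding eventually_sequentially by blast
  show "\<exists>n0. \<forall>G :: nat graph. simple_graph G \<and> card (verts G) \<ge> n0 \<and> free_of H G \<and>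
        real (min_degree G) \<ge> c * real (card (verts G)) \<longrightarrow>
        (\<exists>D\<subseteq>edges G. real (card D) \<le> \<eta> * (real (card (verts G)))\<^sup>2 \<and>
           partite (chromatic_number H - 1) (verts G, edges G - D))"
  proof (intro exI[of _ n0] allI impI)
    fix G :: "nat graph"
    assume "simple_graph G \<and> card (verts G) \<ge> n0 \<and> free_of H G \<and>
        real (min_degree G) \<ge> c * real (card (verts G))"
    then show "\<exists>D\<subseteq>edges G. real (card D) \<le> \<eta> * (real (card (verts G)))\<^sup>2 \<and>
           partite (chromatic_number H - 1) (verts G, edges G - D)"
      using n0[of "card (verts G)" G] H(2) by (simp add: \<G>_def)
  qed
qed

theorem theorem1p3:
  fixes H :: "'a graph"
  assumes "simple_graph H" and "chromatic_number H = 3"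
  shows "\<exists>g::nat. 0 < g \<and> \<not> homomorphic H (cycle_graph (2 * g + 1)) \<and>
           (\<forall>k. 0 < k \<and> k < g \<longrightarrow> homomorphic H (cycle_graph (2 * k + 1))) \<and>
           stability_threshold H = 2 / (2 * real g + 1)"
proof -
  define g where "g = (LEAST g. 0 < g \<and> \<not> homomorphic H (cycle_graph (2 * g + 1)))"
  note chi = chromatic_number_three[OF assms]
  have g: "0 < g" "\<not> homomorphic H (cycle_graph (2 * g + 1))"
    using LeastI_ex[OF not_bipartite_imp_not_hom_long_cycle[OF chi(2)]]
    by (auto simp: g_def)
  have hom: "homomorphic H (cycle_graph (2 * k + 1))" if "0 < k" "k < g" for k
    using not_less_Least[of k "\<lambda>g. 0 < g \<and> \<not> homomorphic H (cycle_graph (2 * g + 1))"] that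
    by (auto simp: g_def)
  \<comment> \<open>A proper 3-colouring is a homomorphism to the triangle.\<close>
  have "g \<noteq> 1"
  proof
    assume "g = 1"
    then show False using g(2) partite_three_imp_hom_triangle[OF assms(1) chi(1)] by simp
  qed
  then have g2: "2 \<le> g" using g(1) by linarith
  \<comment> \<open>The admissible constants form exactly an open ray, whose endpoint is the
    infimum.\<close>
  have "forces_near_partite H c \<longleftrightarrow> 2 / (2 * real g + 1) < c" for c
  proof
    assume "forces_near_partite H c"
    then have "\<not> c \<le> 2 / real (2 * g + 1)"
      using not_forces_near_partite[OF assms g(2), of c] g(1) by auto
    then show "2 / (2 * real g + 1) < c" by (simp add: add.commute)
  next
    assume "2 / (2 * real g + 1) < c"
    then show "forces_near_partite H c" using forces_near_partite_above[OF assms _ g2] hom by blast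
  qed
  then have "{c. forces_near_partite H c} = {2 / (2 * real g + 1)<..}" by auto
  then have "stability_threshold H = 2 / (2 * real g + 1)" by (simp add: stability_threshold_def)
  then show ?thesis using g hom by blast
qed

end
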